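(* Let $\Phi$ be an irreducible affine reflection system whose underlying finite root system $\mathring{\Phi}$ is of type $C_n$ ($n\ge 3$) or $G_2$. Put $m_{\mathring{\Phi}}=2$ if $\mathring{\Phi}$ is of type $C_n$ and $m_{\mathring{\Phi}}=3$ if $\mathring{\Phi}$ is of type $G_2$, and let $\Gamma_s=\{(\alpha,\beta)\in\mathring{\Phi}_s\times\mathring{\Phi}_s:\alpha+\beta\in\mathring{\Phi}_\ell\}$. A subset $\Psi\subseteq\Phi$ is a maximal closed subroot system with semi-closed gradient if and only if there exist a maximal subgroup $H\subseteq\Lambda_s$ of index $m_{\mathring{\Phi}}$ which contains $\Lambda_\ell$ and a $\mathbb{Z}$-linear function $\tau:\mathring{\Phi}_s\to\Lambda_s/H$ satisfying $\tau(\alpha)\neq-\tau(\beta)$ for all $(\alpha,\beta)\in\Gamma_s$ such that $$\Psi=\{\alpha\oplus\tau(\alpha):\alpha\in\mathring{\Phi}_s\}.$$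
   Context: Finite root systems: $V$ is a finite-dimensional real Euclidean space with inner product $(\cdot,\cdot)$. A finite root system $\mathring{\Phi}\subset V$ is a finite spanning set with $0\notin\mathring{\Phi}$, $s_\alpha(\mathring{\Phi})=\mathring{\Phi}$ and $(\beta,\alpha^\vee)\in\mathbb{Z}$ for all $\alpha,\beta\in\mathring{\Phi}$, where $\alpha^\vee=2\alpha/(\alpha,\alpha)$ and $s_\alpha(v)=v-(v,\alpha^\vee)\alpha$. $\mathring{\Phi}_s$ and $\mathring{\Phi}_\ell$ are the sets of short and long roots. Extension datum (for reduced $\mathring{\Phi}$): a family $(\Lambda_\alpha)_{\alpha\in\mathring{\Phi}\cup\{0\}}$ of subsets of a finite-dimensional real vector space $Y$ such that (1) $\Lambda_\beta-(\beta,\alpha^\vee)\Lambda_\alpha\subseteq\Lambda_{s_\alpha(\beta)}$ for all $\alpha,\beta\in\mathring{\Phi}$; (2) $0\in\Lambda_\alpha$ for all $\alpha\in\mathring{\Phi}\cup\{0\}$; (3) $Y$ is the real span of $\bigcup_\alpha\Lambda_\alpha$. For $\mathring{\Phi}$ irreducible, $\Lambda_\alpha$ ($\alpha\in\mathring{\Phi}$) depends only on the length of $\alpha$; the common values on short and long roots are denoted $\Lambda_s$ and $\Lambda_\ell$. For types $C_n$ ($n\ge3$) and $G_2$, $\Lambda_s$ is a subgroup of $Y$. Affine reflection system: up to isomorphism, every affine reflection system is $\Phi=\bigcup_{\alpha\in\mathring{\Phi}\cup\{0\}}\alpha\oplus\Lambda_\alpha\subset X=V\oplus Y$ with form $(v_1\oplus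 y_1,v_2\oplus y_2)_X=(v_1,v_2)$, for a finite root system $\mathring{\Phi}$ and an extension datum; it is irreducible iff $\mathring{\Phi}$ is. Here $\alpha\oplus S=\{\alpha\oplus y:y\in S\}$ for a subset $S\subseteq Y$ (in particular for a coset $S$; in the displayed formula $\{\alpha\oplus\tau(\alpha)\}$ denotes the union of these sets). The real roots are $\Phi^{\mathrm{re}}=\bigcup_{\alpha\in\mathring{\Phi}}\alpha\oplus\Lambda_\alpha$, and $s_{\alpha\oplus y}(\beta\oplus z)=s_\alpha(\beta)\oplus(z-(\beta,\alpha^\vee)y)$. Subroot systems: a proper non-empty subset $\Psi\subsetneq\Phi^{\mathrm{re}}$ is a subroot system if $s_a(b)\in\Psi$ for all $a,b\in\Psi$; it is closed if $a,b\in\Psi$ and $a+b\in\Phi^{\mathrm{re}}$ imply $a+b\in\Psi$; it is a maximal closed subroot system if it is a closed subroot system and there is no closed subroot system $\Psi'$ with $\Psi\subsetneq\Psi'\subsetneq\Phi^{\mathrm{re}}$. The gradient is $\mathrm{Gr}(\Psi)=\{\alpha\in\mathring{\Phi}:\exists y\in\Lambda_\alpha,\ \alpha\oplus y\in\Psi\}$. Semi-closed: a reflection-stable subset $\mathring{\Phi}'\subseteq\mathring{\Phi}$ is closed if $\alpha,\beta\in\mathring{\Phi}'$, $\alpha+\beta\in\mathring{\Phi}$ imply $\alpha+\beta\in\mathring{\Phi}'$; it is semi-closed if it is not closed and whenever $\alpha,\beta\in\mathring{\Phi}'$ with $\alpha+\beta\in\mathring{\Phi}\setminus\mathring{\Phi}'$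 one has $\alpha,\beta\in\mathring{\Phi}_s$ and $\alpha+\beta\in\mathring{\Phi}_\ell$. $\mathbb{Z}$-linear: a function from a root system to an abelian group is $\mathbb{Z}$-linear if it is the restriction of a group homomorphism defined on the $\mathbb{Z}$-span of the root system. *)

theory Defs
  imports "HOL-Analysis.Analysis" "HOL-Algebra.Elementary_Groups"
begin

section \<open>Finite root systems\<close>

definition coroot :: "'a::real_inner \<Rightarrow> 'a" where
  "coroot \<alpha> = (2 / (\<alpha> \<bullet> \<alpha>)) *\<^sub>R \<alpha>"

definition refl_root :: "'a::real_inner \<Rightarrow> 'a \<Rightarrow> 'a" where
  "refl_root \<alpha> v = v - (v \<bullet> coroot \<alpha>) *\<^sub>R \<alpha>"

definition finite_root_system :: "'a::euclidean_space set \<Rightarrow> bool" where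
  "finite_root_system R \<longleftrightarrow>
     finite R \<and> span R = UNIV \<and> 0 \<notin> R \<and>
     (\<forall>\<alpha>\<in>R. refl_root \<alpha> ` R = R) \<and>
     (\<forall>\<alpha>\<in>R. \<forall>\<beta>\<in>R. \<beta> \<bullet> coroot \<alpha> \<in> \<int>)"

definition reduced_roots :: "'a::real_vector set \<Rightarrow> bool" where
  "reduced_roots R \<longleftrightarrow> (\<forall>\<alpha>\<in>R. \<forall>c::real. c *\<^sub>R \<alpha> \<in> R \<longrightarrow> c = 1 \<or> c = -1)"

definition irreducible_roots :: "'a::real_inner set \<Rightarrow> bool" where
  "irreducible_roots R \<longleftrightarrow>
     R \<noteq> {} \<and>
     \<not> (\<exists>A B. A \<noteq> {} \<and> B \<noteq> {} \<and> A \<union> B = R \<and> A \<inter> B = {} \<and>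
              (\<forall>\<alpha>\<in>A. \<forall>\<beta>\<in>B. \<alpha> \<bullet> \<beta> = 0))"

definition short_roots :: "'a::real_inner set \<Rightarrow> 'a set" where
  "short_roots R = {\<alpha> \<in> R. \<forall>\<beta>\<in>R. norm \<alpha> \<le> norm \<beta>}"

definition long_roots :: "'a::real_inner set \<Rightarrow> 'a set" where
  "long_roots R = {\<alpha> \<in> R. \<forall>\<beta>\<in>R. norm \<beta> \<le> norm \<alpha>}"

text \<open>Isomorphism of root systems: a linear isomorphism between the spanned spaces that maps
  roots onto roots and preserves the Cartan integers. It need not be an isometry.\<close>

definition root_system_iso :: "'a::real_inner set \<Rightarrow> 'c::real_inner set \<Rightarrow> bool" where
  "root_system_iso R S \<longleftrightarrow>
     (\<exists>f. linear f \<and> inj_on f (span R) \<and> f ` R = S \<and>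
          (\<forall>\<alpha>\<in>R. \<forall>\<beta>\<in>R. f \<beta> \<bullet> coroot (f \<alpha>) = \<beta> \<bullet> coroot \<alpha>))"

text \<open>The standard model of \<open>C\<^sub>n\<close>, with \<open>n\<close> the dimension of the ambient space:
  \<open>\<plusminus>e\<^sub>i\<plusminus>e\<^sub>j\<close> for \<open>i \<noteq> j\<close> and \<open>\<plusminus>2e\<^sub>i\<close>, where \<open>e\<^sub>1,\<dots>,e\<^sub>n\<close> is the
  orthonormal basis of the type.\<close>

definition std_C :: "'a::euclidean_space set" where
  "std_C = {s *\<^sub>R b + t *\<^sub>R c | s t b c.
              s \<in> {-1, 1} \<and> t \<in> {-1, 1} \<and> b \<in> Basis \<and> c \<in> Basis \<and> b \<noteq> c}
         \<union> {s *\<^sub>R b | s b. s \<in> {-2, 2} \<and> b \<in> Basis}"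

definition type_C :: "nat \<Rightarrow> 'a::euclidean_space set \<Rightarrow> bool" where
  "type_C n R \<longleftrightarrow> DIM('a) = n \<and> root_system_iso R (std_C :: 'a set)"

text \<open>The standard model of \<open>G\<^sub>2\<close>, inside the plane \<open>x\<^sub>1 + x\<^sub>2 + x\<^sub>3 = 0\<close>.\<close>

definition std_G2 :: "(real ^ 3) set" where
  "std_G2 = {axis i 1 - axis j 1 | i j. i \<noteq> j}
          \<union> {s *\<^sub>R (2 *\<^sub>R axis i 1 - axis j 1 - axis k 1) | s i j k.
               s \<in> {-1, 1} \<and> i \<noteq> j \<and> j \<noteq> k \<and> i \<noteq> k}"

definition type_G2 :: "'a::euclidean_space set \<Rightarrow> bool" where
  "type_G2 R \<longleftrightarrow> root_system_iso R std_G2"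

text \<open>Only meaningful for the types \<open>C\<^sub>n\<close> (\<open>n \<ge> 3\<close>) and \<open>G\<^sub>2\<close>.\<close>

definition m_const :: "'a::euclidean_space set \<Rightarrow> nat" where
  "m_const R = (if \<exists>n\<ge>3. type_C n R then 2 else 3)"

definition Gamma_s :: "'a::real_inner set \<Rightarrow> ('a \<times> 'a) set" where
  "Gamma_s R = {(\<alpha>, \<beta>) \<in> short_roots R \<times> short_roots R. \<alpha> + \<beta> \<in> long_roots R}"

section \<open>Closed and semi-closed subsets\<close>

definition closed_in :: "'a::plus set \<Rightarrow> 'a set \<Rightarrow> bool" where
  "closed_in A S \<longleftrightarrow> (\<forall>a\<in>S. \<forall>b\<in>S. a + b \<in> A \<longrightarrow> a + b \<in> S)"

definition semi_closed :: "'a::real_inner set \<Rightarrow> 'a set \<Rightarrow> bool" where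
  "semi_closed R S \<longleftrightarrow>
     S \<subseteq> R \<and> (\<forall>\<alpha>\<in>S. \<forall>\<beta>\<in>S. refl_root \<alpha> \<beta> \<in> S) \<and>
     \<not> closed_in R S \<and>
     (\<forall>\<alpha>\<in>S. \<forall>\<beta>\<in>S. \<alpha> + \<beta> \<in> R - S \<longrightarrow>
        \<alpha> \<in> short_roots R \<and> \<beta> \<in> short_roots R \<and> \<alpha> + \<beta> \<in> long_roots R)"

section \<open>Extension data and affine reflection systems\<close>

text \<open>The space \<open>Y\<close> is a finite-dimensional subspace of an arbitrary real vector space, so that
  \<open>Y = {0}\<close> is included. Only the values of \<open>\<Lambda>\<close> on \<open>R \<union> {0}\<close> matter.\<close>

definition extension_datum ::
    "'a::euclidean_space set \<Rightarrow> 'b::real_vector set \<Rightarrow> ('a \<Rightarrow> 'b set) \<Rightarrow> bool" where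
  "extension_datum R Y \<Lambda> \<longleftrightarrow>
     (\<exists>B. finite B \<and> span B = Y) \<and>
     (\<forall>\<alpha>\<in>R. \<forall>\<beta>\<in>R. {z - (\<beta> \<bullet> coroot \<alpha>) *\<^sub>R y | z y. z \<in> \<Lambda> \<beta> \<and> y \<in> \<Lambda> \<alpha>}
                        \<subseteq> \<Lambda> (refl_root \<alpha> \<beta>)) \<and>
     (\<forall>\<alpha>\<in>R \<union> {0}. 0 \<in> \<Lambda> \<alpha>) \<and>
     span (\<Union>\<alpha>\<in>R \<union> {0}. \<Lambda> \<alpha>) = Y"

text \<open>An element \<open>\<alpha> \<oplus> y\<close> of \<open>V \<oplus> Y\<close> is the pair \<open>(\<alpha>, y)\<close>.\<close>

definition affine_roots :: "'a::euclidean_space set \<Rightarrow> ('a \<Rightarrow> 'b::real_vector set) \<Rightarrow> ('a \<times> 'b) set" where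
  "affine_roots R \<Lambda> = (\<Union>\<alpha>\<in>R \<union> {0}. {\<alpha>} \<times> \<Lambda> \<alpha>)"

definition real_roots :: "'a::euclidean_space set \<Rightarrow> ('a \<Rightarrow> 'b::real_vector set) \<Rightarrow> ('a \<times> 'b) set" where
  "real_roots R \<Lambda> = (\<Union>\<alpha>\<in>R. {\<alpha>} \<times> \<Lambda> \<alpha>)"

definition irreducible_affine_reflection_system ::
    "'a::euclidean_space set \<Rightarrow> 'b::real_vector set \<Rightarrow> ('a \<Rightarrow> 'b set) \<Rightarrow> bool" where
  "irreducible_affine_reflection_system R Y \<Lambda> \<longleftrightarrow>
     finite_root_system R \<and> reduced_roots R \<and> irreducible_roots R \<and> extension_datum R Y \<Lambda>"

fun aff_refl :: "'a::euclidean_space \<times> 'b::real_vector \<Rightarrow> 'a \<times> 'b \<Rightarrow> 'a \<times> 'b" where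
  "aff_refl (\<alpha>, y) (\<beta>, z) = (refl_root \<alpha> \<beta>, z - (\<beta> \<bullet> coroot \<alpha>) *\<^sub>R y)"

definition subroot_system ::
    "'a::euclidean_space set \<Rightarrow> ('a \<Rightarrow> 'b::real_vector set) \<Rightarrow> ('a \<times> 'b) set \<Rightarrow> bool" where
  "subroot_system R \<Lambda> \<Psi> \<longleftrightarrow>
     \<Psi> \<noteq> {} \<and> \<Psi> \<subset> real_roots R \<Lambda> \<and> (\<forall>a\<in>\<Psi>. \<forall>b\<in>\<Psi>. aff_refl a b \<in> \<Psi>)"

definition closed_subroot_system ::
    "'a::euclidean_space set \<Rightarrow> ('a \<Rightarrow> 'b::real_vector set) \<Rightarrow> ('a \<times> 'b) set \<Rightarrow> bool" where
  "closed_subroot_system R \<Lambda> \<Psi> \<longleftrightarrow>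
     subroot_system R \<Lambda> \<Psi> \<and> closed_in (real_roots R \<Lambda>) \<Psi>"

definition maximal_closed_subroot_system ::
    "'a::euclidean_space set \<Rightarrow> ('a \<Rightarrow> 'b::real_vector set) \<Rightarrow> ('a \<times> 'b) set \<Rightarrow> bool" where
  "maximal_closed_subroot_system R \<Lambda> \<Psi> \<longleftrightarrow>
     closed_subroot_system R \<Lambda> \<Psi> \<and>
     \<not> (\<exists>\<Psi>'. closed_subroot_system R \<Lambda> \<Psi>' \<and> \<Psi> \<subset> \<Psi>' \<and> \<Psi>' \<subset> real_roots R \<Lambda>)"

definition gradient ::
    "'a::euclidean_space set \<Rightarrow> ('a \<Rightarrow> 'b::real_vector set) \<Rightarrow> ('a \<times> 'b) set \<Rightarrow> 'a set" where
  "gradient R \<Lambda> \<Psi> = {\<alpha> \<in> R. \<exists>y\<in>\<Lambda> \<alpha>. (\<alpha>, y) \<in> \<Psi>}"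

text \<open>The common values of \<open>\<Lambda>\<close> on the short and on the long roots; they exist for an
  irreducible affine reflection system.\<close>

definition Lambda_s :: "'a::euclidean_space set \<Rightarrow> ('a \<Rightarrow> 'b set) \<Rightarrow> 'b set" where
  "Lambda_s R \<Lambda> = (THE S. \<forall>\<alpha>\<in>short_roots R. \<Lambda> \<alpha> = S)"

definition Lambda_l :: "'a::euclidean_space set \<Rightarrow> ('a \<Rightarrow> 'b set) \<Rightarrow> 'b set" where
  "Lambda_l R \<Lambda> = (THE S. \<forall>\<alpha>\<in>long_roots R. \<Lambda> \<alpha> = S)"

section \<open>Groups\<close>

text \<open>A subset of an abelian group (when closed under the operations), viewed as a group
  in the sense of HOL-Algebra.\<close>

definition add_group_on :: "'b::ab_group_add set \<Rightarrow> 'b monoid" where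
  "add_group_on S = \<lparr>carrier = S, monoid.mult = (+), one = 0\<rparr>"

definition maximal_subgroup :: "'b set \<Rightarrow> ('b, 'm) monoid_scheme \<Rightarrow> bool" where
  "maximal_subgroup H G \<longleftrightarrow>
     subgroup H G \<and> H \<noteq> carrier G \<and>
     (\<forall>K. subgroup K G \<and> H \<subseteq> K \<longrightarrow> K = H \<or> K = carrier G)"

text \<open>\<open>subgroup_generated (add_group_on UNIV) S\<close> is the \<open>\<int>\<close>-span of \<open>S\<close>.\<close>

definition Z_linear :: "'a::ab_group_add set \<Rightarrow> ('c, 'm) monoid_scheme \<Rightarrow> ('a \<Rightarrow> 'c) \<Rightarrow> bool" where
  "Z_linear S G \<tau> \<longleftrightarrow>
     (\<exists>f \<in> hom (subgroup_generated (add_group_on UNIV) S) G. \<forall>\<alpha>\<in>S. \<tau> \<alpha> = f \<alpha>)"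

end

theory Submission
  imports Defs
begin

text \<open>A closed subroot system with all short roots in its gradient has as fibres over the short
  roots cosets of one subgroup \<open>K\<close> of \<open>\<Lambda>\<^sub>s\<close>, because any two short roots have a
  common neighbour along which differences of fibre elements can be transported. Since the root
  lattice is free, the fibres are \<open>L \<alpha> + K\<close> for a linear map \<open>L\<close>. For a linear \<open>L\<close> and any
  subgroup \<open>K'\<close> the set of real roots \<open>(\<alpha>, y)\<close> with \<open>y - L \<alpha> \<in> K'\<close> is
  automatically closed and reflection-stable. Hence maximality leaves no subgroup strictly between
  \<open>K\<close> and \<open>\<Lambda>\<^sub>s\<close>; applied to \<open>K + m \<Lambda>\<^sub>s\<close> and to \<open>K + \<int> L \<gamma>\<close>
  for a long root \<open>\<gamma>\<close> this yields that \<open>\<Lambda>\<^sub>s / K\<close> is cyclic of order \<open>m\<close>,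
  generated by \<open>L \<gamma>\<close>, and since \<open>\<plusminus>L \<gamma> + K\<close> avoids \<open>\<Lambda>\<^sub>l\<close>, that
  \<open>\<Lambda>\<^sub>l \<subseteq> K\<close>.\<close>

section \<open>Reflections and additive subgroups\<close>

text \<open>The number m enters as a Cartan integer. If a long root is a sum of two short ones,
  equal lengths force the integers 1 and m between summand and sum, and the reflection axiom turns
  them into \<open>\<Lambda>l \<subseteq> \<Lambda>s\<close> and
  \<open>\<Lambda>l + m \<Lambda>s \<subseteq> \<Lambda>l\<close>. The second inclusion is what
  keeps K + m \<open>\<Lambda>s\<close> from reaching L \<gamma>. The last claim of the overview
  rests on m \<le> 3: every integer is 0, 1 or -1 modulo m, so the classes of L \<gamma> and L
  (-\<gamma>) are the only nonzero ones. The obstacle is that the gradient must first be shown to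
  contain every short root. In type C_n a semi-closed subset can be smaller, but then it lies in a
  proper closed subsystem T of the finite roots, and the real roots over T contradict maximality.
  Freeness of the lattice is used in one form: nonempty sets over the short roots that are
  compatible with sums and negatives have a linear selection. It serves twice, for the fibres of
  \<Psi> and, in the converse, for the cosets \<tau>(\<alpha>).\<close>

lemma inner_coroot: "x \<bullet> coroot \<alpha> = 2 * (x \<bullet> \<alpha>) / (\<alpha> \<bullet> \<alpha>)"
  by (simp add: coroot_def)

lemma refl_root_self [simp]: "refl_root \<alpha> \<alpha> = - \<alpha>"
  by (cases "\<alpha> = 0") (auto simp: refl_root_def inner_coroot scaleR_2)

lemma inner_diff_scaleR_self:
  "(x - c *\<^sub>R \<alpha>) \<bullet> (x - c *\<^sub>R \<alpha>) = x \<bullet> x - c * (2 * (x \<bullet> \<alpha>)) + c * (c * (\<alpha> \<bullet> \<alpha>))"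
  by (simp add: inner_diff_left inner_diff_right inner_commute[of \<alpha> x] right_diff_distrib)

lemma inner_refl_root: "refl_root \<alpha> x \<bullet> refl_root \<alpha> x = x \<bullet> x"
proof (cases "\<alpha> = 0")
  case False
  define c where "c = x \<bullet> coroot \<alpha>"
  have "c * (\<alpha> \<bullet> \<alpha>) = 2 * (x \<bullet> \<alpha>)"
    using False by (simp add: c_def inner_coroot)
  then have "c * (c * (\<alpha> \<bullet> \<alpha>)) = c * (2 * (x \<bullet> \<alpha>))"
    by (rule arg_cong)
  then show ?thesis
    unfolding refl_root_def c_def[symmetric] inner_diff_scaleR_self by simp
qed (simp add: refl_root_def)

lemma refl_root_invol: "refl_root \<alpha> (refl_root \<alpha> x) = x"
proof (cases "\<alpha> = 0")
  case False
  then have "refl_root \<alpha> x \<bullet> coroot \<alpha> = - (x \<bullet> coroot \<alpha>)"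
    by (simp add: refl_root_def inner_coroot inner_diff_left field_simps)
  then show ?thesis
    by (simp add: refl_root_def)
qed (simp add: refl_root_def)

text \<open>A line in direction \<alpha> meets the sphere through x in at most one further point,
  the reflected one. Cartan integers can thus be read off from root lengths.\<close>

lemma refl_root_eqI:
  assumes "y = x - c *\<^sub>R \<alpha>" "y \<bullet> y = x \<bullet> x" "c \<noteq> 0" "\<alpha> \<noteq> 0"
  shows "refl_root \<alpha> x = y" "x \<bullet> coroot \<alpha> = c"
proof -
  have "(x - c *\<^sub>R \<alpha>) \<bullet> (x - c *\<^sub>R \<alpha>) = x \<bullet> x"
    using assms by simp
  then have "c * (2 * (x \<bullet> \<alpha>)) = c * (c * (\<alpha> \<bullet> \<alpha>))"
    unfolding inner_diff_scaleR_self by auto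
  then have "2 * (x \<bullet> \<alpha>) = c * (\<alpha> \<bullet> \<alpha>)"
    using \<open>c \<noteq> 0\<close> by auto
  then show "x \<bullet> coroot \<alpha> = c"
    using \<open>\<alpha> \<noteq> 0\<close> by (simp add: inner_coroot)
  then show "refl_root \<alpha> x = y"
    using assms by (simp add: refl_root_def)
qed

text \<open>A predicate on bare sets, closed under subtraction, so that the root arguments stay in
  vector space notation; \<open>subgroup_add_group_on\<close> translates to HOL-Algebra at the
  end.\<close>

definition add_subgroup :: "'b::real_vector set \<Rightarrow> bool" where
  "add_subgroup K \<longleftrightarrow> 0 \<in> K \<and> (\<forall>x\<in>K. \<forall>y\<in>K. x - y \<in> K)"

lemma add_subgroup_minus: "add_subgroup K \<Longrightarrow> x \<in> K \<Longrightarrow> - x \<in> K"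
  unfolding add_subgroup_def by (metis diff_0)

lemma add_subgroup_diff: "add_subgroup K \<Longrightarrow> x \<in> K \<Longrightarrow> y \<in> K \<Longrightarrow> x - y \<in> K"
  by (simp add: add_subgroup_def)

lemma add_subgroup_plus: "add_subgroup K \<Longrightarrow> x \<in> K \<Longrightarrow> y \<in> K \<Longrightarrow> x + y \<in> K"
  using add_subgroup_diff[OF _ _ add_subgroup_minus] by fastforce

lemma add_subgroup_scale_nat: "add_subgroup K \<Longrightarrow> x \<in> K \<Longrightarrow> real n *\<^sub>R x \<in> K"
  by (induction n) (auto simp: scaleR_left_distrib add_subgroup_plus, simp add: add_subgroup_def)

lemma add_subgroup_scale_Ints:
  assumes "add_subgroup K" "x \<in> K" "r \<in> \<int>"
  shows "r *\<^sub>R x \<in> K"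
proof -
  obtain i :: int where r: "r = of_int i"
    using assms(3) by (elim Ints_cases)
  show ?thesis
  proof (cases "i \<ge> 0")
    case True
    then have "r = real (nat i)" by (simp add: r)
    then show ?thesis using add_subgroup_scale_nat assms by blast
  next
    case False
    then have "r = - real (nat (- i))" by (simp add: r)
    then show ?thesis
      using add_subgroup_minus[OF assms(1) add_subgroup_scale_nat[OF assms(1,2)]] by simp
  qed
qed

section \<open>Root systems with two root lengths\<close>

text \<open>Collects what the affine argument uses about the finite root system, so that C_n and G_2
  share one proof. \<open>m\<close> is the ratio of squared lengths. \<open>neighbour\<close> joins
  any two short roots through a third at 60 or 120 degrees to both, \<open>long_translate\<close>
  makes the long roots conjugate up to sign under short reflections, \<open>lift\<close> expresses
  freeness of the short root lattice as a linear selection, and \<open>nonclosed\<close> controls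
  the subsystems that fail to be closed at a sum of two short roots.\<close>

locale affine_two_lengths =
  fixes R :: "'a::euclidean_space set" and Y :: "'b::real_vector set"
    and \<Lambda> :: "'a \<Rightarrow> 'b set" and m :: nat
  assumes root_system: "finite_root_system R"
    and datum: "extension_datum R Y \<Lambda>"
    and m: "m = 2 \<or> m = 3"
    and lengths: "R \<subseteq> short_roots R \<union> long_roots R"
    and ratio: "\<alpha> \<in> short_roots R \<Longrightarrow> \<gamma> \<in> long_roots R \<Longrightarrow> \<gamma> \<bullet> \<gamma> = m * (\<alpha> \<bullet> \<alpha>)"
    and long_nonempty: "long_roots R \<noteq> {}"
    and long_sum: "\<gamma> \<in> long_roots R \<Longrightarrow> \<exists>\<alpha>\<in>short_roots R. \<exists>\<beta>\<in>short_roots R. \<gamma> = \<alpha> + \<beta>"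
    and neighbour: "\<alpha> \<in> short_roots R \<Longrightarrow> \<beta> \<in> short_roots R \<Longrightarrow> \<exists>\<delta>\<in>short_roots R.
        (\<delta> - \<alpha> \<in> short_roots R \<or> \<delta> + \<alpha> \<in> short_roots R) \<and>
        (\<delta> - \<beta> \<in> short_roots R \<or> \<delta> + \<beta> \<in> short_roots R)"
    and long_translate: "\<gamma> \<in> long_roots R \<Longrightarrow> \<gamma>' \<in> long_roots R \<Longrightarrow>
        \<exists>\<delta>\<in>short_roots R. \<exists>c. \<gamma>' - c *\<^sub>R \<delta> \<in> {\<gamma>, - \<gamma>}"
    and lift: "(\<And>\<alpha>. \<alpha> \<in> short_roots R \<Longrightarrow> Z \<alpha> \<noteq> {}) \<Longrightarrow>
        (\<And>\<alpha> y. \<alpha> \<in> short_roots R \<Longrightarrow> y \<in> Z \<alpha> \<Longrightarrow> - y \<in> Z (- \<alpha>)) \<Longrightarrow>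
        (\<And>\<alpha> \<beta> y z. \<alpha> \<in> short_roots R \<Longrightarrow> \<beta> \<in> short_roots R \<Longrightarrow> \<alpha> + \<beta> \<in> short_roots R \<Longrightarrow>
           y \<in> Z \<alpha> \<Longrightarrow> z \<in> Z \<beta> \<Longrightarrow> y + z \<in> Z (\<alpha> + \<beta>)) \<Longrightarrow>
        \<exists>L::'a \<Rightarrow> 'b. linear L \<and> (\<forall>\<alpha>\<in>short_roots R. L \<alpha> \<in> Z \<alpha>)"
    and nonclosed: "S \<subseteq> R \<Longrightarrow> (\<And>\<alpha> \<beta>. \<alpha> \<in> S \<Longrightarrow> \<beta> \<in> S \<Longrightarrow> refl_root \<alpha> \<beta> \<in> S) \<Longrightarrow>
        \<alpha> \<in> S \<Longrightarrow> \<beta> \<in> S \<Longrightarrow> \<alpha> \<in> short_roots R \<Longrightarrow> \<beta> \<in> short_roots R \<Longrightarrow>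
        \<alpha> + \<beta> \<in> long_roots R - S \<Longrightarrow>
        S = short_roots R \<or>
        (\<exists>T. S \<subset> T \<and> T \<subset> R \<and> (\<forall>\<alpha>\<in>T. \<forall>\<beta>\<in>T. refl_root \<alpha> \<beta> \<in> T) \<and> closed_in R T)"
begin

abbreviation "sh \<equiv> short_roots R"
abbreviation "lo \<equiv> long_roots R"
abbreviation "\<Lambda>s \<equiv> Lambda_s R \<Lambda>"
abbreviation "\<Lambda>l \<equiv> Lambda_l R \<Lambda>"
abbreviation "\<Phi> \<equiv> real_roots R \<Lambda>"

section \<open>Short and long roots under reflections\<close>

lemma short_subset: "\<alpha> \<in> sh \<Longrightarrow> \<alpha> \<in> R" and long_subset: "\<alpha> \<in> lo \<Longrightarrow> \<alpha> \<in> R"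
  by (auto simp: short_roots_def long_roots_def)

lemma root_nonzero: "\<alpha> \<in> R \<Longrightarrow> \<alpha> \<noteq> 0"
  using root_system by (auto simp: finite_root_system_def)

lemma root_cases: "\<alpha> \<in> R \<Longrightarrow> \<alpha> \<in> sh \<or> \<alpha> \<in> lo"
  using lengths by auto

lemma refl_in_R: "\<alpha> \<in> R \<Longrightarrow> \<beta> \<in> R \<Longrightarrow> refl_root \<alpha> \<beta> \<in> R"
  using root_system unfolding finite_root_system_def by blast

lemma cartan_Ints: "\<alpha> \<in> R \<Longrightarrow> \<beta> \<in> R \<Longrightarrow> \<beta> \<bullet> coroot \<alpha> \<in> \<int>"
  using root_system by (simp add: finite_root_system_def)

lemma norm_refl: "norm (refl_root \<alpha> x) = norm x"
  by (simp add: norm_eq_sqrt_inner inner_refl_root)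

lemma refl_in_short: "\<alpha> \<in> R \<Longrightarrow> \<beta> \<in> sh \<Longrightarrow> refl_root \<alpha> \<beta> \<in> sh"
  using refl_in_R by (auto simp: short_roots_def norm_refl)

lemma refl_in_long: "\<alpha> \<in> R \<Longrightarrow> \<beta> \<in> lo \<Longrightarrow> refl_root \<alpha> \<beta> \<in> lo"
  using refl_in_R by (auto simp: long_roots_def norm_refl)

lemma neg_short: "\<alpha> \<in> sh \<Longrightarrow> - \<alpha> \<in> sh"
  using refl_in_short[of \<alpha> \<alpha>] short_subset by simp

lemma neg_long: "\<alpha> \<in> lo \<Longrightarrow> - \<alpha> \<in> lo"
  using refl_in_long[of \<alpha> \<alpha>] long_subset by simp

lemma short_inner_eq: "\<alpha> \<in> sh \<Longrightarrow> \<beta> \<in> sh \<Longrightarrow> \<alpha> \<bullet> \<alpha> = \<beta> \<bullet> \<beta>"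
  unfolding norm_eq[symmetric] by (rule order_antisym) (auto simp: short_roots_def)

lemma long_inner_eq: "\<alpha> \<in> lo \<Longrightarrow> \<beta> \<in> lo \<Longrightarrow> \<alpha> \<bullet> \<alpha> = \<beta> \<bullet> \<beta>"
  unfolding norm_eq[symmetric] by (rule order_antisym) (auto simp: long_roots_def)

lemma short_not_long: "\<alpha> \<in> sh \<Longrightarrow> \<alpha> \<notin> lo"
  using ratio[of \<alpha> \<alpha>] m root_nonzero[OF short_subset, of \<alpha>] by auto

lemma short_nonempty: "sh \<noteq> {}"
  using long_nonempty long_sum by blast

section \<open>The extension datum on short and on long roots\<close>

lemma zero_in: "\<alpha> \<in> R \<Longrightarrow> 0 \<in> \<Lambda> \<alpha>"
  using datum by (simp add: extension_datum_def)

lemma datumD: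
  "\<alpha> \<in> R \<Longrightarrow> \<beta> \<in> R \<Longrightarrow> y \<in> \<Lambda> \<alpha> \<Longrightarrow> z \<in> \<Lambda> \<beta> \<Longrightarrow>
   z - (\<beta> \<bullet> coroot \<alpha>) *\<^sub>R y \<in> \<Lambda> (refl_root \<alpha> \<beta>)"
  using datum unfolding extension_datum_def by blast

text \<open>Taking y = 0 in the datum axiom gives one inclusion; applying it again at the reflected
  root gives the other, because reflections are involutions.\<close>

lemma datum_refl:
  assumes "\<alpha> \<in> R" "\<beta> \<in> R"
  shows "\<Lambda> (refl_root \<alpha> \<beta>) = \<Lambda> \<beta>"
proof -
  have sub: "\<Lambda> \<beta>' \<subseteq> \<Lambda> (refl_root \<alpha> \<beta>')" if "\<beta>' \<in> R" for \<beta>'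
    using datumD[OF assms(1) that zero_in[OF assms(1)]] by auto
  show ?thesis
    using sub[OF assms(2)] sub[OF refl_in_R[OF assms]] by (simp add: refl_root_invol)
qed

lemma datum_neg: "\<alpha> \<in> R \<Longrightarrow> \<Lambda> (- \<alpha>) = \<Lambda> \<alpha>"
  using datum_refl[of \<alpha> \<alpha>] by simp

lemma short_cartan:
  assumes "\<alpha> \<in> sh" "\<delta> \<in> sh" "\<delta> - \<alpha> \<in> sh"
  shows "refl_root \<alpha> \<delta> = \<delta> - \<alpha>" "\<delta> \<bullet> coroot \<alpha> = 1"
  using refl_root_eqI[of "\<delta> - \<alpha>" \<delta> 1 \<alpha>] short_inner_eq[of "\<delta> - \<alpha>" \<delta>] assms
    root_nonzero[OF short_subset, of \<alpha>] by auto

text \<open>Short roots at 60 degrees are exchanged by the reflection in their difference; 120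
  degrees reduces to this by negating \<alpha>.\<close>

lemma datum_neighbour:
  assumes "\<alpha> \<in> sh" "\<delta> \<in> sh" "\<delta> - \<alpha> \<in> sh \<or> \<delta> + \<alpha> \<in> sh"
  shows "\<Lambda> \<alpha> = \<Lambda> \<delta>"
proof -
  have *: "\<Lambda> \<alpha> = \<Lambda> \<delta>" if "\<alpha> \<in> sh" "\<delta> - \<alpha> \<in> sh" for \<alpha>
  proof -
    have "refl_root (\<delta> - \<alpha>) \<delta> = \<alpha>"
      using short_cartan(1)[of "\<delta> - \<alpha>" \<delta>] that assms by simp
    then show ?thesis
      using datum_refl[of "\<delta> - \<alpha>" \<delta>, OF short_subset short_subset] that assms by simp
  qed
  show ?thesis
    using assms(3)
  proof
    assume "\<delta> + \<alpha> \<in> sh"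
    then have "\<Lambda> (- \<alpha>) = \<Lambda> \<delta>"
      using *[OF neg_short[OF assms(1)]] by simp
    then show ?thesis
      using datum_neg[OF short_subset[OF assms(1)]] by simp
  qed (rule *[OF assms(1)])
qed

lemma datum_short: "\<alpha> \<in> sh \<Longrightarrow> \<Lambda> \<alpha> = \<Lambda>s"
proof -
  assume a: "\<alpha> \<in> sh"
  have *: "\<Lambda> \<beta> = \<Lambda> \<alpha>" if b: "\<beta> \<in> sh" for \<beta>
  proof -
    obtain \<delta> where d: "\<delta> \<in> sh" "\<delta> - \<alpha> \<in> sh \<or> \<delta> + \<alpha> \<in> sh" "\<delta> - \<beta> \<in> sh \<or> \<delta> + \<beta> \<in> sh"
      using neighbour[OF a b] by blast
    show ?thesis
      using datum_neighbour[OF a d(1,2)] datum_neighbour[OF b d(1,3)] by simp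
  qed
  have "\<Lambda>s = \<Lambda> \<alpha>"
    unfolding Lambda_s_def
  proof (rule the_equality)
    show "\<forall>\<beta>\<in>sh. \<Lambda> \<beta> = \<Lambda> \<alpha>"
      using * by blast
    show "S = \<Lambda> \<alpha>" if "\<forall>\<beta>\<in>sh. \<Lambda> \<beta> = S" for S
      using bspec[OF that a] by simp
  qed
  then show ?thesis by simp
qed

lemma datum_long: "\<gamma> \<in> lo \<Longrightarrow> \<Lambda> \<gamma> = \<Lambda>l"
proof -
  assume a: "\<gamma> \<in> lo"
  have *: "\<Lambda> \<gamma>' = \<Lambda> \<gamma>" if g: "\<gamma>' \<in> lo" for \<gamma>'
  proof -
    obtain \<delta> c where d: "\<delta> \<in> sh" "\<gamma>' - c *\<^sub>R \<delta> \<in> {\<gamma>, - \<gamma>}"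
      using long_translate[OF a g] by auto
    have "\<Lambda> (\<gamma>' - c *\<^sub>R \<delta>) = \<Lambda> \<gamma>'"
    proof (cases "c = 0")
      case False
      have "\<gamma>' - c *\<^sub>R \<delta> \<in> lo"
        using d(2) a neg_long by auto
      then have "refl_root \<delta> \<gamma>' = \<gamma>' - c *\<^sub>R \<delta>"
        by (intro refl_root_eqI(1)[OF refl long_inner_eq[OF _ g] False]
            root_nonzero[OF short_subset[OF d(1)]])
      then show ?thesis
        using datum_refl[OF short_subset[OF d(1)] long_subset[OF g]] by simp
    qed simp
    moreover have "\<Lambda> (\<gamma>' - c *\<^sub>R \<delta>) = \<Lambda> \<gamma>"
      using d(2) datum_neg[OF long_subset[OF a]] by (elim insertE) simp_all
    ultimately show ?thesis by simp
  qed
  have "\<Lambda>l = \<Lambda> \<gamma>"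
    unfolding Lambda_l_def
  proof (rule the_equality)
    show "\<forall>\<beta>\<in>lo. \<Lambda> \<beta> = \<Lambda> \<gamma>"
      using * by blast
    show "S = \<Lambda> \<gamma>" if "\<forall>\<beta>\<in>lo. \<Lambda> \<beta> = S" for S
      using bspec[OF that a] by simp
  qed
  then show ?thesis by simp
qed

lemma zero_in_Ls: "0 \<in> \<Lambda>s" and zero_in_Ll: "0 \<in> \<Lambda>l"
  using short_nonempty long_nonempty zero_in datum_short datum_long short_subset long_subset
  by blast+

text \<open>For two short roots at 60 degrees the Cartan integer is 1, and the datum axiom becomes
  closure under subtraction.\<close>

lemma subgroup_Ls: "add_subgroup \<Lambda>s"
proof -
  obtain \<alpha>0 where a0: "\<alpha>0 \<in> sh"
    using short_nonempty by auto
  then obtain \<delta>0 where "\<delta>0 \<in> sh" "\<delta>0 - \<alpha>0 \<in> sh \<or> \<delta>0 - (- \<alpha>0) \<in> sh"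
    using neighbour[OF a0 a0] by auto
  then obtain \<alpha> \<delta> where a: "\<alpha> \<in> sh" "\<delta> \<in> sh" "\<delta> - \<alpha> \<in> sh"
    using a0 neg_short by blast
  have "z - y \<in> \<Lambda>s" if "z \<in> \<Lambda>s" "y \<in> \<Lambda>s" for y z
    using datumD[of \<alpha> \<delta> y z] short_cartan[OF a] a that short_subset datum_short by simp
  then show ?thesis
    by (simp add: add_subgroup_def zero_in_Ls)
qed

text \<open>Equal lengths of \<alpha> and \<beta> give the integer 1, that is, twice the inner
  product of \<alpha> and \<alpha> + \<beta> is the squared length of \<alpha> + \<beta>. Dividing
  by the squared length of \<alpha> instead yields the length ratio m.\<close>

lemma long_cartan:
  assumes "\<alpha> \<in> sh" "\<beta> \<in> sh" "\<alpha> + \<beta> \<in> lo"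
  shows "refl_root (\<alpha> + \<beta>) \<alpha> = - \<beta>" "\<alpha> \<bullet> coroot (\<alpha> + \<beta>) = 1" "(\<alpha> + \<beta>) \<bullet> coroot \<alpha> = m"
proof -
  have nz: "\<alpha> + \<beta> \<noteq> 0" "\<alpha> \<noteq> 0"
    using assms root_nonzero short_subset long_subset by blast+
  show 1: "refl_root (\<alpha> + \<beta>) \<alpha> = - \<beta>" "\<alpha> \<bullet> coroot (\<alpha> + \<beta>) = 1"
    using refl_root_eqI[of "- \<beta>" \<alpha> 1 "\<alpha> + \<beta>"] short_inner_eq[of \<alpha> \<beta>] assms nz by auto
  have "2 * (\<alpha> \<bullet> (\<alpha> + \<beta>)) = (\<alpha> + \<beta>) \<bullet> (\<alpha> + \<beta>)"
    using 1(2) nz by (simp add: inner_coroot field_simps)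
  then show "(\<alpha> + \<beta>) \<bullet> coroot \<alpha> = m"
    using ratio[OF assms(1,3)] nz
    by (simp add: inner_coroot inner_commute[of "\<alpha> + \<beta>" \<alpha>])
qed

lemma Ll_subset_Ls: "\<Lambda>l \<subseteq> \<Lambda>s"
proof
  fix y assume y: "y \<in> \<Lambda>l"
  obtain \<alpha> \<beta> where a: "\<alpha> \<in> sh" "\<beta> \<in> sh" "\<alpha> + \<beta> \<in> lo"
    using long_nonempty long_sum by blast
  have "0 - y \<in> \<Lambda>s"
    using datumD[of "\<alpha> + \<beta>" \<alpha> y 0] a y short_subset long_subset datum_long zero_in_Ls
      long_cartan[OF a] datum_short[OF neg_short[OF a(2)]] datum_short[OF a(1)] by simp
  then show "y \<in> \<Lambda>s"
    using add_subgroup_minus[OF subgroup_Ls] by fastforce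
qed

text \<open>Reflecting a long root in a short summand uses the Cartan integer m; -y is inserted
  because reflections subtract.\<close>

lemma scale_Ls_in_Ll: "y \<in> \<Lambda>s \<Longrightarrow> z \<in> \<Lambda>l \<Longrightarrow> z + real m *\<^sub>R y \<in> \<Lambda>l"
proof -
  assume y: "y \<in> \<Lambda>s" and z: "z \<in> \<Lambda>l"
  obtain \<alpha> \<beta> where a: "\<alpha> \<in> sh" "\<beta> \<in> sh" "\<alpha> + \<beta> \<in> lo"
    using long_nonempty long_sum by blast
  have "z - real m *\<^sub>R (- y) \<in> \<Lambda> (refl_root \<alpha> (\<alpha> + \<beta>))"
    using datumD[of \<alpha> "\<alpha> + \<beta>" "- y" z] long_cartan(3)[OF a] a short_subset long_subset
      datum_short datum_long y z add_subgroup_minus[OF subgroup_Ls y] by simp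
  then show ?thesis
    using datum_long[OF refl_in_long[OF short_subset[OF a(1)] a(3)]] by simp
qed

section \<open>Real roots over the cosets of a subgroup\<close>

lemma real_roots_iff: "(\<alpha>, y) \<in> \<Phi> \<longleftrightarrow> \<alpha> \<in> sh \<and> y \<in> \<Lambda>s \<or> \<alpha> \<in> lo \<and> y \<in> \<Lambda>l"
proof -
  have "(\<alpha>, y) \<in> \<Phi> \<longleftrightarrow> \<alpha> \<in> R \<and> y \<in> \<Lambda> \<alpha>"
    by (auto simp: real_roots_def)
  then show ?thesis
    using root_cases[of \<alpha>] short_subset[of \<alpha>] long_subset[of \<alpha>] datum_short[of \<alpha>] datum_long[of \<alpha>]
    by metis
qed

lemma real_roots_subset: "(\<alpha>, y) \<in> \<Phi> \<Longrightarrow> \<alpha> \<in> R \<and> y \<in> \<Lambda>s"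
  using real_roots_iff Ll_subset_Ls short_subset long_subset by blast

lemma aff_refl_in_real_roots: "a \<in> \<Phi> \<Longrightarrow> b \<in> \<Phi> \<Longrightarrow> aff_refl a b \<in> \<Phi>"
  using datumD refl_in_R by (cases a; cases b) (auto simp: real_roots_def)

text \<open>The preimage of K under the additive map (\<alpha>, y) \<mapsto> y - L \<alpha>, cut
  down to the real roots. Sums and affine reflections are integral combinations, so they cannot
  leave such a preimage when K is a subgroup.\<close>

definition coset_roots :: "('a \<Rightarrow> 'b) \<Rightarrow> 'b set \<Rightarrow> ('a \<times> 'b) set" where
  "coset_roots L K = {(\<alpha>, y) \<in> \<Phi>. y - L \<alpha> \<in> K}"

lemma coset_roots_closed_in:
  assumes "linear L" "add_subgroup K"
  shows "closed_in \<Phi> (coset_roots L K)"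
proof -
  have "y + y' - L (\<alpha> + \<alpha>') \<in> K" if "y - L \<alpha> \<in> K" "y' - L \<alpha>' \<in> K" for \<alpha> \<alpha>' y y'
    using add_subgroup_plus[OF assms(2) that] by (simp add: linear_add[OF assms(1)] algebra_simps)
  then show ?thesis
    by (auto simp: closed_in_def coset_roots_def)
qed

lemma coset_roots_refl:
  assumes "linear L" "add_subgroup K" "a \<in> coset_roots L K" "b \<in> coset_roots L K"
  shows "aff_refl a b \<in> coset_roots L K"
proof -
  obtain \<alpha> y \<beta> z where ab: "a = (\<alpha>, y)" "b = (\<beta>, z)" by fastforce
  have R: "\<alpha> \<in> R" "\<beta> \<in> R"
    using assms(3,4) real_roots_subset by (auto simp: ab coset_roots_def)
  have "(z - L \<beta>) - (\<beta> \<bullet> coroot \<alpha>) *\<^sub>R (y - L \<alpha>) \<in> K"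
    using add_subgroup_diff[OF assms(2) _ add_subgroup_scale_Ints[OF assms(2) _ cartan_Ints[OF R]]]
      assms(3,4) by (simp add: ab coset_roots_def)
  then show ?thesis
    using assms(3,4) aff_refl_in_real_roots[of a b]
    by (simp add: ab coset_roots_def refl_root_def linear_diff[OF assms(1)] linear_cmul[OF assms(1)]
        algebra_simps)
qed

lemma coset_roots_closed_subroot_system:
  assumes "linear L" "add_subgroup K" "coset_roots L K \<noteq> {}" "coset_roots L K \<noteq> \<Phi>"
  shows "closed_subroot_system R \<Lambda> (coset_roots L K)"
  using coset_roots_refl[OF assms(1,2)] coset_roots_closed_in[OF assms(1,2)] assms(3,4)
  by (auto simp: closed_subroot_system_def subroot_system_def coset_roots_def)

section \<open>Transport of differences inside a closed subroot system\<close>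

lemma closed_neg:
  assumes "closed_subroot_system R \<Lambda> P" "(\<alpha>, y) \<in> P"
  shows "(- \<alpha>, - y) \<in> P"
proof -
  have "\<alpha> \<noteq> 0"
    using assms real_roots_subset root_nonzero
    by (auto simp: closed_subroot_system_def subroot_system_def)
  then have "\<alpha> \<bullet> coroot \<alpha> = 2"
    by (simp add: inner_coroot)
  moreover have "aff_refl (\<alpha>, y) (\<alpha>, y) \<in> P"
    using assms unfolding closed_subroot_system_def subroot_system_def by blast
  ultimately show ?thesis
    by (simp add: scaleR_2)
qed

lemma closed_subroot_subset: "closed_subroot_system R \<Lambda> P \<Longrightarrow> P \<subseteq> \<Phi>"
  by (auto simp: closed_subroot_system_def subroot_system_def)

lemma closed_add:
  assumes "closed_subroot_system R \<Lambda> P" "(\<alpha>, y) \<in> P" "(\<beta>, z) \<in> P" "(\<alpha> + \<beta>, y + z) \<in> \<Phi>"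
  shows "(\<alpha> + \<beta>, y + z) \<in> P"
  using assms unfolding closed_subroot_system_def closed_in_def by (metis add_Pair)

text \<open>Every element of the group \<open>\<Lambda>s\<close> occurs over a short root, so
  closedness applies to any sum of members whose gradient part is short.\<close>

lemma closed_add_short:
  assumes "closed_subroot_system R \<Lambda> P" "(\<alpha>, y) \<in> P" "(\<beta>, z) \<in> P" "\<alpha> + \<beta> \<in> sh"
  shows "(\<alpha> + \<beta>, y + z) \<in> P"
proof -
  have "y \<in> \<Lambda>s" "z \<in> \<Lambda>s"
    using assms closed_subroot_subset real_roots_subset by blast+
  then show ?thesis
    using closed_add[OF assms(1-3)] assms(4) add_subgroup_plus[OF subgroup_Ls]
    by (simp add: real_roots_iff)
qed

text \<open>One moves from \<delta> to \<delta> - \<alpha> with y' and back with y, or to \<delta> +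
  \<alpha> with y and back with y'. Both stops are short, so closedness applies, and the round trip
  shifts z by y - y'.\<close>

lemma translate_neighbour:
  assumes P: "closed_subroot_system R \<Lambda> P"
    and y: "(\<alpha>, y) \<in> P" "(\<alpha>, y') \<in> P" and z: "(\<delta>, z) \<in> P"
    and sh: "\<alpha> \<in> sh" "\<delta> \<in> sh" "\<delta> - \<alpha> \<in> sh \<or> \<delta> + \<alpha> \<in> sh"
  shows "(\<delta>, z + (y - y')) \<in> P"
proof -
  consider "\<delta> - \<alpha> \<in> sh" | "\<delta> + \<alpha> \<in> sh"
    using sh(3) by blast
  then show ?thesis
  proof cases
    case 1
    then have "(\<delta> - \<alpha>, z - y') \<in> P"
      using closed_add_short[OF P z closed_neg[OF P y(2)]] by simp
    then show ?thesis
      using closed_add_short[OF P _ y(1)] sh(2) by (fastforce simp: algebra_simps)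
  next
    case 2
    then have "(\<delta> + \<alpha>, z + y) \<in> P"
      using closed_add_short[OF P z y(1)] by simp
    then show ?thesis
      using closed_add_short[OF P _ closed_neg[OF P y(2)]] sh(2) by (fastforce simp: algebra_simps)
  qed
qed

lemma translate_short:
  assumes P: "closed_subroot_system R \<Lambda> P"
    and full: "\<And>\<alpha>. \<alpha> \<in> sh \<Longrightarrow> \<exists>y. (\<alpha>, y) \<in> P"
    and y: "(\<alpha>, y) \<in> P" "(\<alpha>, y') \<in> P" and z: "(\<beta>, z) \<in> P" and sh: "\<alpha> \<in> sh" "\<beta> \<in> sh"
  shows "(\<beta>, z + (y - y')) \<in> P"
proof -
  obtain \<delta> where d: "\<delta> \<in> sh" "\<delta> - \<alpha> \<in> sh \<or> \<delta> + \<alpha> \<in> sh" "\<delta> - \<beta> \<in> sh \<or> \<delta> + \<beta> \<in> sh"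
    using neighbour[OF sh] by blast
  obtain w where w: "(\<delta>, w) \<in> P"
    using full[OF d(1)] by blast
  have w': "(\<delta>, w + (y - y')) \<in> P"
    by (rule translate_neighbour[OF P y w sh(1) d(1,2)])
  have "\<beta> - \<delta> \<in> sh \<or> \<beta> + \<delta> \<in> sh"
    using d(3) neg_short by (metis add.commute minus_diff_eq)
  then show ?thesis
    using translate_neighbour[OF P w' w z d(1) sh(2)] by simp
qed

text \<open>Both signs are required so that this is a subgroup for every set \<open>P\<close>. For a
  closed system with members over all short roots, \<open>diff_in_stabiliser\<close> makes each
  short fibre a coset of it.\<close>

definition stabiliser :: "('a \<times> 'b) set \<Rightarrow> 'b set" where
  "stabiliser P = {k \<in> \<Lambda>s. \<forall>\<beta>\<in>sh. \<forall>z. (\<beta>, z) \<in> P \<longrightarrow> (\<beta>, z + k) \<in> P \<and> (\<beta>, z - k) \<in> P}"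

lemma stabiliser_subgroup: "add_subgroup (stabiliser P)"
proof -
  have "x - y \<in> stabiliser P" if "x \<in> stabiliser P" "y \<in> stabiliser P" for x y
  proof -
    have "(\<beta>, z + (x - y)) \<in> P \<and> (\<beta>, z - (x - y)) \<in> P" if "\<beta> \<in> sh" "(\<beta>, z) \<in> P" for \<beta> z
    proof -
      have "(\<beta>, z + x - y) \<in> P" "(\<beta>, z - x + y) \<in> P"
        using \<open>x \<in> stabiliser P\<close> \<open>y \<in> stabiliser P\<close> that unfolding stabiliser_def by blast+
      then show ?thesis by (simp add: algebra_simps)
    qed
    then show ?thesis
      using that add_subgroup_diff[OF subgroup_Ls] by (simp add: stabiliser_def)
  qed
  then show ?thesis
    by (auto simp: add_subgroup_def stabiliser_def zero_in_Ls)
qed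

lemma stabiliser_subset: "stabiliser P \<subseteq> \<Lambda>s"
  by (auto simp: stabiliser_def)

lemma diff_in_stabiliser:
  assumes P: "closed_subroot_system R \<Lambda> P"
    and full: "\<And>\<alpha>. \<alpha> \<in> sh \<Longrightarrow> \<exists>y. (\<alpha>, y) \<in> P"
    and y: "(\<alpha>, y) \<in> P" "(\<alpha>, y') \<in> P" and sh: "\<alpha> \<in> sh"
  shows "y - y' \<in> stabiliser P"
proof -
  have "(\<beta>, z + (y - y')) \<in> P \<and> (\<beta>, z - (y - y')) \<in> P" if "\<beta> \<in> sh" "(\<beta>, z) \<in> P" for \<beta> z
    using translate_short[OF P full y that(2) sh that(1)]
      translate_short[OF P full y(2,1) that(2) sh that(1)] by (simp add: algebra_simps)
  moreover have "y - y' \<in> \<Lambda>s"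
    using add_subgroup_diff[OF subgroup_Ls] y closed_subroot_subset[OF P] real_roots_subset by blast
  ultimately show ?thesis
    by (simp add: stabiliser_def)
qed

section \<open>Admissible pairs and maximal closed subroot systems\<close>

definition short_coset_roots :: "('a \<Rightarrow> 'b) \<Rightarrow> 'b set \<Rightarrow> ('a \<times> 'b) set" where
  "short_coset_roots L K = {(\<alpha>, y). \<alpha> \<in> sh \<and> y - L \<alpha> \<in> K}"

text \<open>The data (H, \<tau>) of the theorem with \<tau> lifted to a linear map. The condition on
  \<Gamma>_s becomes the last conjunct: \<tau>(\<alpha>) = -\<tau>(\<beta>) means that L (\<alpha> +
  \<beta>) lies in H.\<close>

definition admissible :: "('a \<Rightarrow> 'b) \<Rightarrow> 'b set \<Rightarrow> bool" where
  "admissible L H \<longleftrightarrow> linear L \<and> (\<forall>\<alpha>\<in>sh. L \<alpha> \<in> \<Lambda>s) \<and> add_subgroup H \<and> H \<subset> \<Lambda>s \<and>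
     (\<forall>K. add_subgroup K \<and> H \<subseteq> K \<and> K \<subseteq> \<Lambda>s \<longrightarrow> K = H \<or> K = \<Lambda>s) \<and>
     \<Lambda>l \<subseteq> H \<and> (\<forall>\<gamma>\<in>lo. L \<gamma> \<notin> H)"

text \<open>A closed Q above the system has a stabiliser containing H, hence equal to H or to
  \<open>\<Lambda>s\<close>. If it is \<open>\<Lambda>s\<close>, then Q contains all short and
  therefore all long real roots. If it is H, a new member lies over a long root \<gamma>;
  subtracting the fibre element of one short summand leads back to a short fibre and forces L
  \<gamma> into H.\<close>

lemma admissible_imp_maximal:
  assumes adm: "admissible L H"
  shows "maximal_closed_subroot_system R \<Lambda> (short_coset_roots L H)"
    and "semi_closed R (gradient R \<Lambda> (short_coset_roots L H))"
proof -
  let ?P = "short_coset_roots L H"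
  have L: "linear L" "\<And>\<alpha>. \<alpha> \<in> sh \<Longrightarrow> L \<alpha> \<in> \<Lambda>s" and H: "add_subgroup H" "H \<subseteq> \<Lambda>s"
    and max: "\<And>K. add_subgroup K \<Longrightarrow> H \<subseteq> K \<Longrightarrow> K \<subseteq> \<Lambda>s \<Longrightarrow> K = H \<or> K = \<Lambda>s"
    and Ll: "\<Lambda>l \<subseteq> H" and Lg: "\<And>\<gamma>. \<gamma> \<in> lo \<Longrightarrow> L \<gamma> \<notin> H"
    using adm by (auto simp: admissible_def)
  have in_P: "(\<alpha>, L \<alpha> + h) \<in> ?P" if "\<alpha> \<in> sh" "h \<in> H" for \<alpha> h
    using that by (simp add: short_coset_roots_def)
  have in_P0: "(\<alpha>, L \<alpha>) \<in> ?P" if "\<alpha> \<in> sh" for \<alpha>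
    using in_P[OF that, of 0] H by (simp add: add_subgroup_def)
  \<comment> \<open>This brings in the general closedness result. The long fibres of
    \<open>coset_roots L H\<close> are empty, since their elements would lie in
    \<open>\<Lambda>l \<subseteq> H\<close> while L \<gamma> does not.\<close>
  have eq: "?P = coset_roots L H"
  proof -
    have "y \<in> \<Lambda>s" if "\<alpha> \<in> sh" "y - L \<alpha> \<in> H" for \<alpha> y
      using add_subgroup_plus[OF subgroup_Ls _ L(2)[OF that(1)], of "y - L \<alpha>"] H(2) that(2) by auto
    moreover have "\<not> (y - L \<alpha> \<in> H)" if "\<alpha> \<in> lo" "y \<in> \<Lambda>l" for \<alpha> y
    proof
      assume "y - L \<alpha> \<in> H"
      then have "y - (y - L \<alpha>) \<in> H"
        using add_subgroup_diff[OF H(1)] that(2) Ll by blast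
      then show False using Lg[OF that(1)] by simp
    qed
    ultimately show ?thesis
      by (auto simp: short_coset_roots_def coset_roots_def real_roots_iff)
  qed
  obtain \<gamma> where g: "\<gamma> \<in> lo" using long_nonempty by blast
  have "(\<gamma>, 0) \<in> \<Phi> - ?P"
    using g short_not_long zero_in_Ll by (auto simp: real_roots_iff short_coset_roots_def)
  moreover have "?P \<noteq> {}"
    using in_P0 short_nonempty by blast
  ultimately have closed: "closed_subroot_system R \<Lambda> ?P"
    unfolding eq using L(1) H(1) by (intro coset_roots_closed_subroot_system) auto
  have grad: "gradient R \<Lambda> ?P = sh"
  proof
    show "sh \<subseteq> gradient R \<Lambda> ?P"
    proof
      fix \<alpha> assume a: "\<alpha> \<in> sh"
      then show "\<alpha> \<in> gradient R \<Lambda> ?P"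
        using in_P0[OF a] L(2)[OF a] short_subset[OF a] datum_short[OF a]
        unfolding gradient_def by auto
    qed
  qed (auto simp: gradient_def short_coset_roots_def)
  have "\<not> closed_in R sh"
    using long_sum[OF g] g short_not_long long_subset unfolding closed_in_def by metis
  then show "semi_closed R (gradient R \<Lambda> ?P)"
    using short_subset refl_in_short root_cases unfolding grad semi_closed_def by blast
  have False if Q: "closed_subroot_system R \<Lambda> Q" "?P \<subset> Q" for Q
  proof -
    have PQ: "a \<in> ?P \<Longrightarrow> a \<in> Q" for a using Q(2) by blast
    have full: "\<exists>y. (\<alpha>, y) \<in> Q" if "\<alpha> \<in> sh" for \<alpha>
      using PQ[OF in_P0[OF that]] by blast
    have HQ: "H \<subseteq> stabiliser Q"
    proof
      fix h assume h: "h \<in> H"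
      obtain \<alpha> where a: "\<alpha> \<in> sh" using short_nonempty by blast
      show "h \<in> stabiliser Q"
        using diff_in_stabiliser[OF Q(1) full PQ[OF in_P[OF a h]] PQ[OF in_P0[OF a]] a] by simp
    qed
    consider "stabiliser Q = \<Lambda>s" | "stabiliser Q = H"
      using max[OF stabiliser_subgroup HQ stabiliser_subset] by blast
    then show False
    proof cases
      case 1
      have short: "(\<alpha>, y) \<in> Q" if a: "\<alpha> \<in> sh" and y: "y \<in> \<Lambda>s" for \<alpha> y
      proof -
        have "y - L \<alpha> \<in> stabiliser Q"
          unfolding 1 using add_subgroup_diff[OF subgroup_Ls y L(2)[OF a]] .
        then have "(\<alpha>, L \<alpha> + (y - L \<alpha>)) \<in> Q"
          using a PQ[OF in_P0[OF a]] unfolding stabiliser_def by blast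
        then show ?thesis by simp
      qed
      have long: "(\<gamma>, y) \<in> Q" if g: "\<gamma> \<in> lo" and y: "y \<in> \<Lambda>l" for \<gamma> y
      proof -
        obtain \<alpha> \<beta> where ab: "\<alpha> \<in> sh" "\<beta> \<in> sh" "\<gamma> = \<alpha> + \<beta>"
          using long_sum[OF g] by blast
        \<comment> \<open>As \<open>\<Lambda>l \<subseteq> \<Lambda>s\<close>, the whole shift y can
          be put on one short summand and 0 on the other.\<close>
        have "(\<alpha> + \<beta>, 0 + y) \<in> Q"
          by (rule closed_add[OF Q(1)])
            (use ab short zero_in_Ls Ll_subset_Ls g y in \<open>auto simp: real_roots_iff\<close>)
        then show ?thesis using ab by simp
      qed
      have "\<Phi> \<subseteq> Q"
        using short long by (auto simp: real_roots_iff)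
      then show False
        using Q(1) by (auto simp: closed_subroot_system_def subroot_system_def)
    next
      case 2
      have short: "y - L \<alpha> \<in> H" if "\<alpha> \<in> sh" "(\<alpha>, y) \<in> Q" for \<alpha> y
        using diff_in_stabiliser[OF Q(1) full that(2) PQ[OF in_P0[OF that(1)]] that(1)] 2 by blast
      obtain \<alpha> y where ay: "(\<alpha>, y) \<in> Q" "(\<alpha>, y) \<notin> ?P"
        using Q(2) by auto
      have "\<alpha> \<notin> sh"
        using short ay by (auto simp: short_coset_roots_def)
      then have al: "\<alpha> \<in> lo" "y \<in> \<Lambda>l"
        using ay(1) closed_subroot_subset[OF Q(1)] by (auto simp: real_roots_iff)
      obtain \<alpha>' \<beta> where ab: "\<alpha>' \<in> sh" "\<beta> \<in> sh" "\<alpha> = \<alpha>' + \<beta>"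
        using long_sum[OF al(1)] by blast
      have "(- \<beta>, - L \<beta>) \<in> Q"
        using closed_neg[OF Q(1) PQ[OF in_P0[OF ab(2)]]] .
      then have "(\<alpha>', y - L \<beta>) \<in> Q"
        using closed_add_short[OF Q(1) ay(1), of "- \<beta>" "- L \<beta>"] ab by simp
      then have "y - L \<beta> - L \<alpha>' \<in> H"
        using short ab(1) by blast
      then have "y - (y - L \<beta> - L \<alpha>') \<in> H"
        using add_subgroup_diff[OF H(1)] al(2) Ll by blast
      then show False
        using Lg[OF al(1)] by (simp add: ab(3) linear_add[OF L(1)] algebra_simps)
    qed
  qed
  then show "maximal_closed_subroot_system R \<Lambda> ?P"
    using closed by (auto simp: maximal_closed_subroot_system_def)
qed

text \<open>Semi-closedness says that closedness fails at a short + short = long sum, which is the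
  case treated by \<open>nonclosed\<close>. Its second alternative T would lift to the system of all
  real roots over T, strictly between P and the full set.\<close>

lemma gradient_eq_short:
  assumes max: "maximal_closed_subroot_system R \<Lambda> P" and semi: "semi_closed R (gradient R \<Lambda> P)"
  shows "gradient R \<Lambda> P = sh"
proof (rule ccontr)
  let ?S = "gradient R \<Lambda> P"
  assume ne: "?S \<noteq> sh"
  have sub: "P \<subseteq> \<Phi>"
    using max closed_subroot_subset[of P] by (simp add: maximal_closed_subroot_system_def)
  obtain \<alpha> \<beta> where ab: "\<alpha> \<in> ?S" "\<beta> \<in> ?S" "\<alpha> + \<beta> \<in> R - ?S"
    using semi unfolding semi_closed_def closed_in_def by blast
  then have ab': "\<alpha> \<in> sh" "\<beta> \<in> sh" "\<alpha> + \<beta> \<in> lo"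
    using semi unfolding semi_closed_def by blast+
  have refl: "refl_root \<alpha> \<beta> \<in> ?S" if "\<alpha> \<in> ?S" "\<beta> \<in> ?S" for \<alpha> \<beta>
    using semi that unfolding semi_closed_def by blast
  have "?S = sh \<or> (\<exists>T. ?S \<subset> T \<and> T \<subset> R \<and> (\<forall>\<alpha>\<in>T. \<forall>\<beta>\<in>T. refl_root \<alpha> \<beta> \<in> T) \<and> closed_in R T)"
    proof (rule nonclosed[OF _ refl ab(1,2) ab'(1,2)])
    show "?S \<subseteq> R"
      by (auto simp: gradient_def)
    show "\<alpha> + \<beta> \<in> lo - ?S"
      using ab(3) ab'(3) by blast
  qed
  then obtain T where T: "?S \<subset> T" "T \<subset> R" "\<And>\<alpha> \<beta>. \<alpha> \<in> T \<Longrightarrow> \<beta> \<in> T \<Longrightarrow> refl_root \<alpha> \<beta> \<in> T"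
    "closed_in R T"
    using ne by blast
  define Q where "Q = {(\<alpha>, y) \<in> \<Phi>. \<alpha> \<in> T}"
  have PS: "\<alpha> \<in> ?S" if "(\<alpha>, y) \<in> P" for \<alpha> y
    using that sub by (auto simp: gradient_def real_roots_def)
  have "P \<subseteq> Q"
    using sub PS T(1) by (auto simp: Q_def)
  \<comment> \<open>Every \<Lambda> \<delta> contains 0, so strict inclusions of gradients are
    witnessed at second coordinate 0.\<close>
  moreover have zero: "(\<delta>, 0) \<in> \<Phi>" if "\<delta> \<in> R" for \<delta>
    using that zero_in by (auto simp: real_roots_def)
  obtain \<delta> where "\<delta> \<in> T" "\<delta> \<notin> ?S" using T(1) by blast
  then have "(\<delta>, 0) \<in> Q" "(\<delta>, 0) \<notin> P"
    using zero[of \<delta>] T(2) PS[of \<delta>] by (auto simp: Q_def)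
  moreover obtain \<delta>' where "\<delta>' \<in> R" "\<delta>' \<notin> T" using T(2) by blast
  then have "(\<delta>', 0) \<in> \<Phi>" "(\<delta>', 0) \<notin> Q"
    using zero[of \<delta>'] by (auto simp: Q_def)
  moreover have "Q \<subseteq> \<Phi>"
    by (auto simp: Q_def)
  moreover have "closed_in \<Phi> Q"
  proof -
    have "(\<alpha> + \<beta>, y + z) \<in> Q"
      if "(\<alpha>, y) \<in> Q" "(\<beta>, z) \<in> Q" "(\<alpha> + \<beta>, y + z) \<in> \<Phi>" for \<alpha> \<beta> y z
    proof -
      have "\<alpha> \<in> T" "\<beta> \<in> T" "\<alpha> + \<beta> \<in> R"
        using that real_roots_subset by (auto simp: Q_def)
      then have "\<alpha> + \<beta> \<in> T"
        using T(4) unfolding closed_in_def by blast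
      then show ?thesis using that(3) by (simp add: Q_def)
    qed
    then show ?thesis
      by (simp add: closed_in_def Ball_def split_paired_All)
  qed
  moreover have "aff_refl a b \<in> Q" if ab: "a \<in> Q" "b \<in> Q" for a b
  proof -
    obtain \<alpha> y \<beta> z where eq: "a = (\<alpha>, y)" "b = (\<beta>, z)" by fastforce
    have "a \<in> \<Phi>" "b \<in> \<Phi>" "\<alpha> \<in> T" "\<beta> \<in> T"
      using ab by (auto simp: Q_def eq)
    then have "aff_refl a b \<in> \<Phi>" "refl_root \<alpha> \<beta> \<in> T"
      using aff_refl_in_real_roots T(3) by blast+
    then show ?thesis by (simp add: Q_def eq)
  qed
  ultimately have "P \<subset> Q" "Q \<subset> \<Phi>" "Q \<noteq> {}" "closed_in \<Phi> Q"
    "\<forall>a\<in>Q. \<forall>b\<in>Q. aff_refl a b \<in> Q"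
    by blast+
  then have "closed_subroot_system R \<Lambda> Q" "P \<subset> Q" "Q \<subset> \<Phi>"
    by (simp_all add: closed_subroot_system_def subroot_system_def)
  then show False
    using max unfolding maximal_closed_subroot_system_def by blast
qed

text \<open>The element t and its two properties are exported because
  \<open>card_cosets_cyclic\<close> computes the index of H from them.\<close>

lemma maximal_imp_admissible:
  assumes max: "maximal_closed_subroot_system R \<Lambda> P" and semi: "semi_closed R (gradient R \<Lambda> P)"
  shows "\<exists>L H t. admissible L H \<and> P = short_coset_roots L H \<and>
    t \<in> \<Lambda>s - H \<and> (\<forall>y\<in>\<Lambda>s. real m *\<^sub>R y \<in> H) \<and> (\<forall>y\<in>\<Lambda>s. \<exists>n\<in>\<int>. y - n *\<^sub>R t \<in> H)"
proof -
  have grad: "gradient R \<Lambda> P = sh"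
    using gradient_eq_short[OF max semi] .
  have P: "closed_subroot_system R \<Lambda> P"
    using max by (simp add: maximal_closed_subroot_system_def)
  have sub: "P \<subseteq> \<Phi>"
    using closed_subroot_subset[OF P] .
  have full: "\<exists>y. (\<alpha>, y) \<in> P" if "\<alpha> \<in> sh" for \<alpha>
    using grad that by (auto simp: gradient_def)
  have short: "\<alpha> \<in> sh" if "(\<alpha>, y) \<in> P" for \<alpha> y
    using that grad sub by (auto simp: gradient_def real_roots_def)
  obtain L where L: "linear L" "\<And>\<alpha>. \<alpha> \<in> sh \<Longrightarrow> (\<alpha>, L \<alpha>) \<in> P"
    using lift[of "\<lambda>\<alpha>. {y. (\<alpha>, y) \<in> P}"] full closed_neg[OF P] closed_add_short[OF P]
    by auto
  have LLs: "L \<alpha> \<in> \<Lambda>s" if "\<alpha> \<in> sh" for \<alpha>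
    using L(2)[OF that] sub real_roots_subset by blast
  define K where "K = stabiliser P"
  have K: "add_subgroup K" "K \<subseteq> \<Lambda>s"
    using stabiliser_subgroup stabiliser_subset by (auto simp: K_def)
  have in_P: "(\<alpha>, L \<alpha> + k) \<in> P" if "\<alpha> \<in> sh" "k \<in> K" for \<alpha> k
    using that L(2) by (simp add: K_def stabiliser_def)
  have PK: "P = short_coset_roots L K"
  proof (intro equalityI subsetI)
    fix a assume "a \<in> P"
    then show "a \<in> short_coset_roots L K"
      using diff_in_stabiliser[OF P full _ L(2)] short
      by (cases a) (auto simp: short_coset_roots_def K_def)
  next
    fix a assume "a \<in> short_coset_roots L K"
    then obtain \<alpha> y where "a = (\<alpha>, y)" "\<alpha> \<in> sh" "y - L \<alpha> \<in> K"
      by (auto simp: short_coset_roots_def)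
    then show "a \<in> P" using in_P[of \<alpha> "y - L \<alpha>"] by simp
  qed
  \<comment> \<open>L \<gamma> - k is a sum of fibre elements over two short summands of \<gamma>.
    If it lay in \<open>\<Lambda>l\<close>, closedness would put a member over the long root
    \<gamma> into P.\<close>
  have avoid: "L \<gamma> - k \<notin> \<Lambda>l" if g: "\<gamma> \<in> lo" and k: "k \<in> K" for \<gamma> k
  proof
    assume l: "L \<gamma> - k \<in> \<Lambda>l"
    obtain \<alpha> \<beta> where ab: "\<alpha> \<in> sh" "\<beta> \<in> sh" "\<gamma> = \<alpha> + \<beta>"
      using long_sum[OF g] by blast
    have "(\<beta>, L \<beta> - k) \<in> P"
      using in_P[OF ab(2) add_subgroup_minus[OF K(1) k]] by simp
    moreover have eq: "(\<alpha> + \<beta>, L \<alpha> + (L \<beta> - k)) = (\<gamma>, L \<gamma> - k)"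
      by (simp add: ab linear_add[OF L(1)])
    moreover have "(\<gamma>, L \<gamma> - k) \<in> \<Phi>"
      using g l by (simp add: real_roots_iff)
    ultimately have "(\<gamma>, L \<gamma> - k) \<in> P"
      using closed_add[OF P L(2)[OF ab(1)], of \<beta> "L \<beta> - k"] unfolding eq by blast
    then show False
      using short short_not_long g by blast
  qed
  have LgK: "L \<gamma> \<notin> K" if "\<gamma> \<in> lo" for \<gamma>
    using avoid[OF that, of "L \<gamma>"] zero_in_Ll by auto
  have LgLs: "L \<gamma> \<in> \<Lambda>s" if "\<gamma> \<in> lo" for \<gamma>
    using long_sum[OF that] LLs add_subgroup_plus[OF subgroup_Ls] linear_add[OF L(1)] by metis
  obtain \<alpha>0 where a0: "\<alpha>0 \<in> sh" using short_nonempty by blast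
  \<comment> \<open>By maximality \<open>coset_roots L K'\<close> is P or everything; comparing the
    fibres over a single short root translates this into K' = K or K' =
    \<open>\<Lambda>s\<close>.\<close>
  have enlarge: "K' = K \<or> K' = \<Lambda>s" if K': "add_subgroup K'" "K \<subseteq> K'" "K' \<subseteq> \<Lambda>s" for K'
  proof -
    have PK': "P \<subseteq> coset_roots L K'"
      using PK sub K'(2) by (auto simp: short_coset_roots_def coset_roots_def)
    show ?thesis
    proof (cases "coset_roots L K' = \<Phi>")
      case True
      have *: "y - L \<alpha>0 \<in> K'" if "y \<in> \<Lambda>s" for y
      proof -
        have "(\<alpha>0, y) \<in> coset_roots L K'"
          using a0 that unfolding True real_roots_iff by blast
        then show ?thesis by (simp add: coset_roots_def)
      qed
      have "y \<in> K'" if "y \<in> \<Lambda>s" for y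
        using add_subgroup_diff[OF K'(1) *[OF that] *[OF zero_in_Ls]] by simp
      then show ?thesis using K'(3) by blast
    next
      case False
      then have "closed_subroot_system R \<Lambda> (coset_roots L K')"
        using coset_roots_closed_subroot_system[OF L(1) K'(1)] PK' L(2) short_nonempty by blast
      then have eq: "coset_roots L K' = P"
        using max PK' closed_subroot_subset False
        unfolding maximal_closed_subroot_system_def by blast
      have "k \<in> K" if k: "k \<in> K'" for k
      proof -
        have "(\<alpha>0, L \<alpha>0 + k) \<in> coset_roots L K'"
          using k a0 K'(3) LLs add_subgroup_plus[OF subgroup_Ls]
          by (auto simp: coset_roots_def real_roots_iff)
        then show ?thesis
          by (simp add: eq PK short_coset_roots_def)
      qed
      then show ?thesis using K'(2) by blast
    qed
  qed
  obtain \<gamma> where g: "\<gamma> \<in> lo" using long_nonempty by blast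
  define t where "t = L \<gamma>"
  have t: "t \<in> \<Lambda>s - K"
    using LgK[OF g] LgLs[OF g] by (simp add: t_def)
  have mK: "real m *\<^sub>R y \<in> K" if y: "y \<in> \<Lambda>s" for y
  proof -
    define K' where "K' = {k + real m *\<^sub>R x | k x. k \<in> K \<and> x \<in> \<Lambda>s}"
    have "add_subgroup K'"
    proof -
      have "0 + real m *\<^sub>R 0 \<in> K'"
        using K(1) zero_in_Ls unfolding K'_def add_subgroup_def by blast
      moreover have "u - v \<in> K'" if uv: "u \<in> K'" "v \<in> K'" for u v
      proof -
        obtain k x k' x' where *: "u = k + real m *\<^sub>R x" "v = k' + real m *\<^sub>R x'"
          "k \<in> K" "k' \<in> K" "x \<in> \<Lambda>s" "x' \<in> \<Lambda>s"
          using uv unfolding K'_def by blast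
        then have "u - v = (k - k') + real m *\<^sub>R (x - x')"
          by (simp add: algebra_simps)
        then show ?thesis
          using * add_subgroup_diff[OF K(1)] add_subgroup_diff[OF subgroup_Ls] unfolding K'_def by blast
      qed
      ultimately show ?thesis by (simp add: add_subgroup_def)
    qed
    moreover have "k + real m *\<^sub>R 0 \<in> K'" if "k \<in> K" for k
      using that zero_in_Ls unfolding K'_def by blast
    then have "K \<subseteq> K'" by auto
    moreover have "K' \<subseteq> \<Lambda>s"
      using add_subgroup_plus[OF subgroup_Ls] add_subgroup_scale_nat[OF subgroup_Ls] K(2)
      by (auto simp: K'_def)
    ultimately have "K' = K \<or> K' = \<Lambda>s" by (rule enlarge)
    \<comment> \<open>Otherwise t differs from an element of K by some m x, which lies in
      \<open>\<Lambda>l\<close>, contrary to \<open>avoid\<close>.\<close>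
    moreover have "K' \<noteq> \<Lambda>s"
    proof
      assume "K' = \<Lambda>s"
      then obtain k x where "t = k + real m *\<^sub>R x" "k \<in> K" "x \<in> \<Lambda>s"
        using t unfolding K'_def by blast
      then have "L \<gamma> - k \<in> \<Lambda>l"
        using scale_Ls_in_Ll[OF _ zero_in_Ll] by (simp add: t_def)
      then show False using avoid[OF g] \<open>k \<in> K\<close> by blast
    qed
    moreover have "0 + real m *\<^sub>R y \<in> K'"
      using y K(1) unfolding K'_def add_subgroup_def by blast
    ultimately show ?thesis by simp
  qed
  have gen: "\<exists>n\<in>\<int>. y - n *\<^sub>R t \<in> K" if y: "y \<in> \<Lambda>s" for y
  proof -
    define K' where "K' = {x \<in> \<Lambda>s. \<exists>n\<in>\<int>. x - n *\<^sub>R t \<in> K}"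
    have "add_subgroup K'"
    proof -
      have "0 \<in> K'"
        using K(1) zero_in_Ls unfolding K'_def add_subgroup_def
        by (auto intro!: bexI[of _ 0])
      moreover have "u - v \<in> K'" if uv: "u \<in> K'" "v \<in> K'" for u v
      proof -
        obtain n n' where *: "u \<in> \<Lambda>s" "v \<in> \<Lambda>s" "n \<in> \<int>" "n' \<in> \<int>" "u - n *\<^sub>R t \<in> K" "v - n' *\<^sub>R t \<in> K"
          using uv unfolding K'_def by blast
        have "(u - v) - (n - n') *\<^sub>R t \<in> K"
          using add_subgroup_diff[OF K(1) *(5,6)] by (simp add: algebra_simps)
        then show ?thesis
          using * add_subgroup_diff[OF subgroup_Ls] Ints_diff unfolding K'_def by blast
      qed
      ultimately show ?thesis by (simp add: add_subgroup_def)
    qed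
    moreover have "K \<subseteq> K'"
      using K(2) by (auto simp: K'_def intro!: bexI[of _ 0])
    moreover have "K' \<subseteq> \<Lambda>s" by (auto simp: K'_def)
    ultimately have "K' = K \<or> K' = \<Lambda>s" by (rule enlarge)
    moreover have "t \<in> K'"
      using t K(1) by (auto simp: K'_def add_subgroup_def intro!: bexI[of _ 1])
    ultimately have "K' = \<Lambda>s" using t by blast
    then show ?thesis using y unfolding K'_def by blast
  qed
  have "\<Lambda>l \<subseteq> K"
  proof
    fix y assume y: "y \<in> \<Lambda>l"
    obtain r where r: "r \<in> \<int>" "y - r *\<^sub>R t \<in> K"
      using gen y Ll_subset_Ls by blast
    obtain n :: int where n: "r = of_int n" using r(1) by (elim Ints_cases)
    \<comment> \<open>Residues modulo 2 or 3 have representatives 0, 1 and -1. Thus y is congruent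
      to 0, t or -t modulo K, and \<open>avoid\<close> at \<gamma> and at -\<gamma> excludes the
      last two unless y is already in K.\<close>
    have "\<exists>q. n = int m * q \<or> n = int m * q + 1 \<or> n = int m * q - 1"
      using m by (elim disjE) (simp_all, presburger+)
    then obtain q e where q: "n = int m * q + e" and e: "e \<in> {0, 1, -1}"
      by force
    have "real m *\<^sub>R (of_int q *\<^sub>R t) \<in> K"
      using mK add_subgroup_scale_Ints[OF subgroup_Ls _ Ints_of_int] t by blast
    from add_subgroup_plus[OF K(1) r(2) this] have k: "y - of_int e *\<^sub>R t \<in> K"
      by (simp add: n q algebra_simps)
    consider "e = 0" | "e = 1" | "e = -1" using e by blast
    then show "y \<in> K"
    proof cases
      case 1
      then show ?thesis using k by simp
    next
      case 2
      then have "L \<gamma> - (- (y - t)) \<in> \<Lambda>l"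
        using y by (simp add: t_def)
      then show ?thesis
        using avoid[OF g add_subgroup_minus[OF K(1) k]] 2 by simp
    next
      case 3
      then have "L (- \<gamma>) - (- (y + t)) \<in> \<Lambda>l"
        using y by (simp add: t_def linear_neg[OF L(1)])
      then show ?thesis
        using avoid[OF neg_long[OF g] add_subgroup_minus[OF K(1) k]] 3 by simp
    qed
  qed
  then have "admissible L K"
    using L(1) LLs K LgK enlarge t unfolding admissible_def by blast
  then show ?thesis
    using PK t mK gen by blast
qed

end

section \<open>Type \<open>C\<^sub>n\<close>\<close>

definition C_short :: "'i set \<Rightarrow> ('i \<Rightarrow> 'a::euclidean_space) \<Rightarrow> 'a set" where
  "C_short I \<epsilon> = {s *\<^sub>R \<epsilon> i + t *\<^sub>R \<epsilon> j | s t i j.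
     s \<in> {-1, 1} \<and> t \<in> {-1, 1} \<and> i \<in> I \<and> j \<in> I \<and> i \<noteq> j}"

definition C_long :: "'i set \<Rightarrow> ('i \<Rightarrow> 'a::euclidean_space) \<Rightarrow> 'a set" where
  "C_long I \<epsilon> = {s *\<^sub>R \<epsilon> i | s i. s \<in> {-2, 2} \<and> i \<in> I}"

text \<open>The vectors are orthogonal of a common squared length c rather than orthonormal, because
  an isomorphism of root systems may rescale the inner product.\<close>

locale C_roots =
  fixes I :: "'i set" and \<epsilon> :: "'i \<Rightarrow> 'a::euclidean_space" and c :: real and R :: "'a set"
  assumes card: "3 \<le> card I" and pos: "0 < c"
    and orth: "i \<in> I \<Longrightarrow> j \<in> I \<Longrightarrow> \<epsilon> i \<bullet> \<epsilon> j = (if i = j then c else 0)"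
    and R_eq: "R = C_short I \<epsilon> \<union> C_long I \<epsilon>"
begin

abbreviation "Csh \<equiv> C_short I \<epsilon>"
abbreviation "Clo \<equiv> C_long I \<epsilon>"

lemma finite_I: "finite I"
  using card by (metis card.infinite not_numeral_le_zero)

lemma shortI:
  "s \<in> {-1, 1} \<Longrightarrow> t \<in> {-1, 1} \<Longrightarrow> i \<in> I \<Longrightarrow> j \<in> I \<Longrightarrow> i \<noteq> j \<Longrightarrow> x = s *\<^sub>R \<epsilon> i + t *\<^sub>R \<epsilon> j \<Longrightarrow> x \<in> Csh"
  unfolding C_short_def by blast

lemma shortE:
  assumes "x \<in> Csh"
  obtains s t i j where "s = -1 \<or> s = 1" "t = -1 \<or> t = 1" "i \<in> I" "j \<in> I" "i \<noteq> j"
    "x = s *\<^sub>R \<epsilon> i + t *\<^sub>R \<epsilon> j"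
  using assms unfolding C_short_def by blast

lemma longI: "s \<in> {-2, 2} \<Longrightarrow> i \<in> I \<Longrightarrow> x = s *\<^sub>R \<epsilon> i \<Longrightarrow> x \<in> Clo"
  unfolding C_long_def by blast

lemma longE:
  assumes "x \<in> Clo"
  obtains s i where "s = -2 \<or> s = 2" "i \<in> I" "x = s *\<^sub>R \<epsilon> i"
  using assms unfolding C_long_def by blast

text \<open>This is where n \<ge> 3 enters: two short roots on the same pair of indices need an
  index outside that pair to have a common neighbour.\<close>

lemma third: "\<exists>k\<in>I. k \<noteq> i \<and> k \<noteq> j"
proof (rule ccontr)
  assume "\<not> (\<exists>k\<in>I. k \<noteq> i \<and> k \<noteq> j)"
  then have "I \<subseteq> {i, j}" by blast
  then have "card I \<le> card {i, j}" by (rule card_mono[rotated]) simp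
  also have "card {i, j} \<le> 2" by (simp add: card_insert_if)
  finally show False using card by simp
qed

lemma short_inner: "x \<in> Csh \<Longrightarrow> x \<bullet> x = 2 * c"
  by (elim shortE) (auto simp: inner_add_left inner_add_right orth)

lemma long_inner: "x \<in> Clo \<Longrightarrow> x \<bullet> x = 4 * c"
  by (elim longE) (auto simp: orth)

lemma ex_short: "Csh \<noteq> {}" and ex_long: "Clo \<noteq> {}"
proof -
  obtain i where i: "i \<in> I" using third by blast
  obtain j where j: "j \<in> I" "j \<noteq> i" using third by blast
  show "Csh \<noteq> {}" using shortI[of 1 1 i j, OF _ _ i j(1) _ refl] j by auto
  show "Clo \<noteq> {}" using longI[of 2 i, OF _ i refl] by auto
qed

lemma short_roots_eq: "short_roots R = Csh"
proof -
  obtain y where "y \<in> Csh" using ex_short by blast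
  then show ?thesis
    using pos short_inner long_inner unfolding short_roots_def R_eq norm_le
    by (force simp: norm_le)
qed

lemma long_roots_eq: "long_roots R = Clo"
proof -
  obtain y where "y \<in> Clo" using ex_long by blast
  then show ?thesis
    using pos short_inner long_inner unfolding long_roots_def R_eq norm_le
    by (force simp: norm_le)
qed

lemma refl_short:
  assumes "\<alpha> \<in> Csh" "x \<bullet> \<alpha> = k * c"
  shows "refl_root \<alpha> x = x - k *\<^sub>R \<alpha>"
  using pos by (simp add: refl_root_def inner_coroot short_inner[OF assms(1)] assms(2))

text \<open>If \<beta> has an index k outside {i, j}, the neighbour combines the k-term of \<beta>
  with a term of \<alpha> whose index does not occur in \<beta>. If both roots use {i, j}, it
  combines the i-term of \<alpha> with a third index p.\<close>

lemma C_neighbour: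
  assumes "\<alpha> \<in> Csh" "\<beta> \<in> Csh"
  shows "\<exists>\<delta>\<in>Csh. (\<delta> - \<alpha> \<in> Csh \<or> \<delta> + \<alpha> \<in> Csh) \<and> (\<delta> - \<beta> \<in> Csh \<or> \<delta> + \<beta> \<in> Csh)"
proof -
  obtain s t i j where a: "s = -1 \<or> s = 1" "t = -1 \<or> t = 1" "i \<in> I" "j \<in> I" "i \<noteq> j"
    "\<alpha> = s *\<^sub>R \<epsilon> i + t *\<^sub>R \<epsilon> j"
    using assms(1) by (rule shortE)
  obtain u v k l where b: "u = -1 \<or> u = 1" "v = -1 \<or> v = 1" "k \<in> I" "l \<in> I" "k \<noteq> l"
    "\<beta> = u *\<^sub>R \<epsilon> k + v *\<^sub>R \<epsilon> l"
    using assms(2) by (rule shortE)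
  have new: ?thesis if b: "u = -1 \<or> u = 1" "v = -1 \<or> v = 1" "k \<in> I" "l \<in> I" "k \<noteq> l"
    "\<beta> = u *\<^sub>R \<epsilon> k + v *\<^sub>R \<epsilon> l" and k: "k \<noteq> i" "k \<noteq> j" for u v k l
  proof (cases "l = i")
    case False
    have "s *\<^sub>R \<epsilon> i + u *\<^sub>R \<epsilon> k \<in> Csh"
      by (rule shortI[of s u i k]) (use a b k in auto)
    moreover have "s *\<^sub>R \<epsilon> i + u *\<^sub>R \<epsilon> k - \<alpha> \<in> Csh"
      by (rule shortI[of u "- t" k j]) (use a b k in auto)
    moreover have "s *\<^sub>R \<epsilon> i + u *\<^sub>R \<epsilon> k - \<beta> \<in> Csh"
      by (rule shortI[of s "- v" i l]) (use a b k False in auto)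
    ultimately show ?thesis by blast
  next
    case True
    have "t *\<^sub>R \<epsilon> j + u *\<^sub>R \<epsilon> k \<in> Csh"
      by (rule shortI[of t u j k]) (use a b k in auto)
    moreover have "t *\<^sub>R \<epsilon> j + u *\<^sub>R \<epsilon> k - \<alpha> \<in> Csh"
      by (rule shortI[of u "- s" k i]) (use a b k in auto)
    moreover have "t *\<^sub>R \<epsilon> j + u *\<^sub>R \<epsilon> k - \<beta> \<in> Csh"
      by (rule shortI[of t "- v" j l]) (use a b k True in auto)
    ultimately show ?thesis by blast
  qed
  have same: ?thesis if b: "u = -1 \<or> u = 1" "v = -1 \<or> v = 1"
    "\<beta> = u *\<^sub>R \<epsilon> i + v *\<^sub>R \<epsilon> j" for u v
  proof -
    obtain p where p: "p \<in> I" "p \<noteq> i" "p \<noteq> j" using third by blast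
    have "s *\<^sub>R \<epsilon> i + \<epsilon> p \<in> Csh"
      by (rule shortI[of s 1 i p]) (use a p in auto)
    moreover have "s *\<^sub>R \<epsilon> i + \<epsilon> p - \<alpha> \<in> Csh"
      by (rule shortI[of 1 "- t" p j]) (use a p in auto)
    moreover have "s *\<^sub>R \<epsilon> i + \<epsilon> p - \<beta> \<in> Csh \<or> s *\<^sub>R \<epsilon> i + \<epsilon> p + \<beta> \<in> Csh"
    proof (cases "u = s")
      case True
      have "s *\<^sub>R \<epsilon> i + \<epsilon> p - \<beta> \<in> Csh"
        by (rule shortI[of 1 "- v" p j]) (use a b p True in auto)
      then show ?thesis ..
    next
      case False
      then have "u = - s" using a b by auto
      then have "s *\<^sub>R \<epsilon> i + \<epsilon> p + \<beta> \<in> Csh"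
        by (intro shortI[of 1 v p j]) (use a b p in auto)
      then show ?thesis ..
    qed
    ultimately show ?thesis by blast
  qed
  consider "k \<noteq> i" "k \<noteq> j" | "l \<noteq> i" "l \<noteq> j" | "k = i" "l = j" | "k = j" "l = i"
    using b(5) by blast
  then show ?thesis
  proof cases
    case 1
    then show ?thesis using new[OF b] by simp
  next
    case 2
    then show ?thesis using new[OF b(2,1,4,3)] b(5,6) by (simp add: add.commute)
  next
    case 3
    then show ?thesis using same[OF b(1,2)] b(6) by simp
  next
    case 4
    then show ?thesis using same[OF b(2,1)] b(6) by (simp add: add.commute)
  qed
qed

lemma C_long_sum:
  assumes "\<gamma> \<in> Clo"
  shows "\<exists>\<alpha>\<in>Csh. \<exists>\<beta>\<in>Csh. \<gamma> = \<alpha> + \<beta>"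
proof -
  obtain s i where s: "s = -2 \<or> s = 2" "i \<in> I" "\<gamma> = s *\<^sub>R \<epsilon> i"
    using assms by (rule longE)
  obtain j where j: "j \<in> I" "j \<noteq> i" using third by blast
  have "(s / 2) *\<^sub>R \<epsilon> i + 1 *\<^sub>R \<epsilon> j \<in> Csh" "(s / 2) *\<^sub>R \<epsilon> i + (- 1) *\<^sub>R \<epsilon> j \<in> Csh"
    using s j by (intro shortI[OF _ _ _ _ _ refl]; auto)+
  moreover have "\<gamma> = ((s / 2) *\<^sub>R \<epsilon> i + 1 *\<^sub>R \<epsilon> j) + ((s / 2) *\<^sub>R \<epsilon> i + (- 1) *\<^sub>R \<epsilon> j)"
    by (simp add: s(3) flip: scaleR_left_distrib)
  ultimately show ?thesis by blast
qed

lemma C_long_translate: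
  assumes "\<gamma> \<in> Clo" "\<gamma>' \<in> Clo"
  shows "\<exists>\<delta>\<in>Csh. \<exists>k. \<gamma>' - k *\<^sub>R \<delta> \<in> {\<gamma>, - \<gamma>}"
proof -
  obtain s i where s: "s = -2 \<or> s = 2" "i \<in> I" "\<gamma> = s *\<^sub>R \<epsilon> i"
    using assms(1) by (rule longE)
  obtain t j where t: "t = -2 \<or> t = 2" "j \<in> I" "\<gamma>' = t *\<^sub>R \<epsilon> j"
    using assms(2) by (rule longE)
  show ?thesis
  proof (cases "i = j")
    case True
    obtain \<delta> where "\<delta> \<in> Csh" using ex_short by blast
    moreover have "\<gamma>' - 0 *\<^sub>R \<delta> \<in> {\<gamma>, - \<gamma>}"
      using s t True by auto
    ultimately show ?thesis by blast
  next
    case False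
    have "1 *\<^sub>R \<epsilon> j + (- 1) *\<^sub>R \<epsilon> i \<in> Csh"
      using s t False by (intro shortI[OF _ _ _ _ _ refl]) auto
    moreover have "\<gamma>' - t *\<^sub>R (1 *\<^sub>R \<epsilon> j + (- 1) *\<^sub>R \<epsilon> i) = t *\<^sub>R \<epsilon> i"
      by (simp add: t(3) algebra_simps)
    then have "\<gamma>' - t *\<^sub>R (1 *\<^sub>R \<epsilon> j + (- 1) *\<^sub>R \<epsilon> i) \<in> {\<gamma>, - \<gamma>}"
      using s t by auto
    ultimately show ?thesis by blast
  qed
qed

text \<open>The short roots form a root system of type \<open>D\<^sub>n\<close>, and the values at \<open>\<epsilon>\<^sub>p - \<epsilon>\<^sub>q\<close> and
  at all \<open>\<epsilon>\<^sub>p + \<epsilon>\<^sub>i\<close> can be prescribed freely.\<close>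

lemma C_lift:
  fixes Z :: "'a \<Rightarrow> 'b::real_vector set"
  assumes ne: "\<And>\<alpha>. \<alpha> \<in> Csh \<Longrightarrow> Z \<alpha> \<noteq> {}"
    and neg: "\<And>\<alpha> y. \<alpha> \<in> Csh \<Longrightarrow> y \<in> Z \<alpha> \<Longrightarrow> - y \<in> Z (- \<alpha>)"
    and add: "\<And>\<alpha> \<beta> y z. \<alpha> \<in> Csh \<Longrightarrow> \<beta> \<in> Csh \<Longrightarrow> \<alpha> + \<beta> \<in> Csh \<Longrightarrow> y \<in> Z \<alpha> \<Longrightarrow> z \<in> Z \<beta> \<Longrightarrow>
      y + z \<in> Z (\<alpha> + \<beta>)"
  shows "\<exists>L. linear L \<and> (\<forall>\<alpha>\<in>Csh. L \<alpha> \<in> Z \<alpha>)"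
proof -
  obtain p where p: "p \<in> I" using third by blast
  obtain q where q: "q \<in> I" "q \<noteq> p" using third by blast
  define P where "P i = (SOME y. y \<in> Z (\<epsilon> p + \<epsilon> i))" for i
  define N where "N = (SOME y. y \<in> Z (\<epsilon> p - \<epsilon> q))"
  have plus: "\<epsilon> p + \<epsilon> i \<in> Csh" and minus: "\<epsilon> p - \<epsilon> i \<in> Csh" if "i \<in> I" "i \<noteq> p" for i
    using that p by (auto intro: shortI[of 1 1 p i] shortI[of 1 "- 1" p i])
  have P: "P i \<in> Z (\<epsilon> p + \<epsilon> i)" if "i \<in> I" "i \<noteq> p" for i
    unfolding P_def using ne[OF plus[OF that]] by (simp add: some_in_eq)
  have N: "N \<in> Z (\<epsilon> p - \<epsilon> q)"
    unfolding N_def using ne[OF minus[OF q]] by (simp add: some_in_eq)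
  \<comment> \<open>The solution of w p + w i = P i and w p - w q = N. Halving is possible because
    the target is a real vector space.\<close>
  define w where "w i = (if i = p then (1/2) *\<^sub>R (P q + N) else P i - (1/2) *\<^sub>R (P q + N))" for i
  define L where "L x = (\<Sum>i\<in>I. ((x \<bullet> \<epsilon> i) / c) *\<^sub>R w i)" for x
  have lin: "linear L"
    by (rule linearI)
      (simp_all add: L_def inner_add_left add_divide_distrib scaleR_left_distrib sum.distrib scaleR_sum_right)
  have L\<epsilon>: "L (\<epsilon> i) = w i" if "i \<in> I" for i
  proof -
    have "L (\<epsilon> i) = (\<Sum>j\<in>I. if i = j then w j else 0)"
      unfolding L_def using pos that by (intro sum.cong) (auto simp: orth)
    then show ?thesis using finite_I that by simp
  qed
  \<comment> \<open>The set where L is a correct selection is stable under negation and under sums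
    within the short roots, so it suffices to reach every short root from the prescribed
    ones.\<close>
  define G where "G x \<longleftrightarrow> L x \<in> Z x" for x
  have Gneg: "G (- x)" if "x \<in> Csh" "G x" for x
    using neg that by (simp add: G_def linear_neg[OF lin])
  have Gadd: "G (x + y)" if "x \<in> Csh" "y \<in> Csh" "x + y \<in> Csh" "G x" "G y" for x y
    using add that by (simp add: G_def linear_add[OF lin])
  have neg_in: "- x \<in> Csh" if "x \<in> Csh" for x
    using that
  proof (rule shortE)
    fix s t i j
    assume "s = -1 \<or> s = 1" "t = -1 \<or> t = 1" "i \<in> I" "j \<in> I" "i \<noteq> j"
      and "x = s *\<^sub>R \<epsilon> i + t *\<^sub>R \<epsilon> j"
    then show "- x \<in> Csh"
      by (intro shortI[of "- s" "- t" i j]) auto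
  qed
  have Gplus: "G (\<epsilon> p + \<epsilon> i)" if "i \<in> I" "i \<noteq> p" for i
    using P[OF that] that p by (simp add: G_def linear_add[OF lin] L\<epsilon> w_def)
  have "w p - w q = N"
    using q by (simp add: w_def algebra_simps flip: scaleR_left_distrib)
  then have Gq: "G (\<epsilon> p - \<epsilon> q)"
    using N p q by (simp add: G_def linear_diff[OF lin] L\<epsilon>)
  \<comment> \<open>The path runs through \<epsilon> q - \<epsilon> i, the difference of two
    prescribed roots, so that every partial sum is a short root.\<close>
  have Gminus: "G (\<epsilon> p - \<epsilon> i)" if i: "i \<in> I" "i \<noteq> p" for i
  proof (cases "i = q")
    case False
    have qi: "\<epsilon> q - \<epsilon> i \<in> Csh"
      using False q i by (intro shortI[of 1 "- 1" q i]) auto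
    have "G ((\<epsilon> p + \<epsilon> q) + - (\<epsilon> p + \<epsilon> i))"
      by (rule Gadd[OF plus[OF q] neg_in[OF plus[OF i]] _ Gplus[OF q] Gneg[OF plus[OF i] Gplus[OF i]]])
        (use qi in simp)
    then have "G ((\<epsilon> p - \<epsilon> q) + (\<epsilon> q - \<epsilon> i))"
      by (intro Gadd) (use minus[OF q] minus[OF i] Gq qi in auto)
    then show ?thesis by simp
  qed (use Gq in simp)
  have Gp: "\<epsilon> p + t *\<^sub>R \<epsilon> i \<in> Csh \<and> G (\<epsilon> p + t *\<^sub>R \<epsilon> i)"
    if "t = -1 \<or> t = 1" "i \<in> I" "i \<noteq> p" for t i
    using that Gplus[of i] Gminus[of i] plus[of i] minus[of i] by auto
  have Gsp: "G (s *\<^sub>R \<epsilon> p + t *\<^sub>R \<epsilon> i)" if "s = -1 \<or> s = 1" "t = -1 \<or> t = 1" "i \<in> I" "i \<noteq> p" for s t i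
    using that(1)
  proof
    assume s: "s = -1"
    have "- t = -1 \<or> - t = 1" using that(2) by auto
    from Gneg[of "\<epsilon> p + (- t) *\<^sub>R \<epsilon> i"] Gp[OF this that(3,4)] show ?thesis
      by (simp add: s)
  qed (use Gp[OF that(2-4)] in simp)
  have "G x" if "x \<in> Csh" for x
    using that
  proof (rule shortE)
    fix s t i j
    assume st: "s = -1 \<or> s = 1" "t = -1 \<or> t = 1" and ij: "i \<in> I" "j \<in> I" "i \<noteq> j"
      and x: "x = s *\<^sub>R \<epsilon> i + t *\<^sub>R \<epsilon> j"
    consider "i = p" | "j = p" | "i \<noteq> p" "j \<noteq> p" by blast
    then show "G x"
    proof cases
      case 1
      then show ?thesis using Gsp[OF st, of j] ij x by simp
    next
      case 2
      then show ?thesis using Gsp[OF st(2,1), of i] ij x by (simp add: add.commute)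
    next
      case 3
      have s': "- s = -1 \<or> - s = 1" using st(1) by auto
      have eq: "(\<epsilon> p + t *\<^sub>R \<epsilon> j) + - (\<epsilon> p + (- s) *\<^sub>R \<epsilon> i) = x"
        by (simp add: x)
      show ?thesis
        using Gadd[of "\<epsilon> p + t *\<^sub>R \<epsilon> j" "- (\<epsilon> p + (- s) *\<^sub>R \<epsilon> i)"] Gp[OF st(2) ij(2) 3(2)]
          Gp[OF s' ij(1) 3(1)] neg_in Gneg that unfolding eq by blast
    qed
  qed
  then show ?thesis
    using lin unfolding G_def by blast
qed

text \<open>A root is a combination of just those \<epsilon> i with which it has nonzero inner
  product, and on these y vanishes.\<close>

lemma inner_zero_split:
  assumes x: "x \<in> R" and J: "\<And>i. i \<in> J \<Longrightarrow> x \<bullet> \<epsilon> i = 0" "\<And>i. i \<in> I - J \<Longrightarrow> y \<bullet> \<epsilon> i = 0"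
  shows "x \<bullet> y = 0"
proof -
  consider "x \<in> Csh" | "x \<in> Clo" using x R_eq by blast
  then show ?thesis
  proof cases
    case 1
    then obtain s t i j where a: "s = -1 \<or> s = 1" "t = -1 \<or> t = 1" "i \<in> I" "j \<in> I" "i \<noteq> j"
      "x = s *\<^sub>R \<epsilon> i + t *\<^sub>R \<epsilon> j"
      by (rule shortE)
    have "x \<bullet> \<epsilon> i \<noteq> 0" "x \<bullet> \<epsilon> j \<noteq> 0"
      using a pos by (auto simp: inner_add_left orth)
    then have "y \<bullet> \<epsilon> i = 0" "y \<bullet> \<epsilon> j = 0"
      using J a by blast+
    then show ?thesis
      by (simp add: a(6) inner_add_left inner_commute[of "\<epsilon> _" y])
  next
    case 2
    then obtain s i where a: "s = -2 \<or> s = 2" "i \<in> I" "x = s *\<^sub>R \<epsilon> i"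
      by (rule longE)
    have "x \<bullet> \<epsilon> i \<noteq> 0"
      using a pos by (auto simp: orth)
    then have "y \<bullet> \<epsilon> i = 0"
      using J a by blast
    then show ?thesis
      by (simp add: a inner_commute[of _ y])
  qed
qed

text \<open>Two roots on the same side of the splitting have sum and reflection on that side. Roots
  on opposite sides are orthogonal, so reflections fix them. Their sum is not a root: its squared
  length is at least 4c, so it would be a multiple of a single \<epsilon> i, and the summand
  vanishing at i would have length zero.\<close>

lemma split_closed:
  assumes refl_R: "\<And>\<alpha> \<beta>. \<alpha> \<in> R \<Longrightarrow> \<beta> \<in> R \<Longrightarrow> refl_root \<alpha> \<beta> \<in> R"
    and T: "T = {x \<in> R. (\<forall>i\<in>J. x \<bullet> \<epsilon> i = 0) \<or> (\<forall>i\<in>I - J. x \<bullet> \<epsilon> i = 0)}"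
  shows "\<forall>x\<in>T. \<forall>y\<in>T. refl_root x y \<in> T" "closed_in R T"
proof -
  have split: "(\<forall>i\<in>J. x \<bullet> \<epsilon> i = 0 \<and> y \<bullet> \<epsilon> i = 0) \<or> (\<forall>i\<in>I - J. x \<bullet> \<epsilon> i = 0 \<and> y \<bullet> \<epsilon> i = 0) \<or>
      x \<bullet> y = 0 \<and> (\<forall>i\<in>I. x \<bullet> \<epsilon> i = 0 \<or> y \<bullet> \<epsilon> i = 0)" if "x \<in> T" "y \<in> T" for x y
  proof -
    have xy: "x \<in> R" "y \<in> R" using that T by auto
    have x: "(\<forall>i\<in>J. x \<bullet> \<epsilon> i = 0) \<or> (\<forall>i\<in>I - J. x \<bullet> \<epsilon> i = 0)"
      and y: "(\<forall>i\<in>J. y \<bullet> \<epsilon> i = 0) \<or> (\<forall>i\<in>I - J. y \<bullet> \<epsilon> i = 0)"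
      using that T by auto
    have "x \<bullet> y = 0" if "\<forall>i\<in>J. x \<bullet> \<epsilon> i = 0" "\<forall>i\<in>I - J. y \<bullet> \<epsilon> i = 0"
      using inner_zero_split[OF xy(1), of J y] that by blast
    moreover have "x \<bullet> y = 0" if "\<forall>i\<in>J. y \<bullet> \<epsilon> i = 0" "\<forall>i\<in>I - J. x \<bullet> \<epsilon> i = 0"
      using inner_zero_split[OF xy(2), of J x] that by (subst inner_commute) blast
    ultimately show ?thesis using x y by blast
  qed
  have "refl_root x y \<in> T" if xy: "x \<in> T" "y \<in> T" for x y
  proof (cases "x \<bullet> y = 0")
    case True
    then show ?thesis
      using xy by (simp add: refl_root_def inner_coroot inner_commute)
  next
    case False
    have "refl_root x y \<bullet> \<epsilon> i = 0" if "x \<bullet> \<epsilon> i = 0" "y \<bullet> \<epsilon> i = 0" for i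
      using that by (simp add: refl_root_def inner_diff_left)
    then show ?thesis
      using split[OF xy] False refl_R[of x y] xy unfolding T by blast
  qed
  then show "\<forall>x\<in>T. \<forall>y\<in>T. refl_root x y \<in> T" by blast
  have "x + y \<in> T" if xy: "x \<in> T" "y \<in> T" and R: "x + y \<in> R" for x y
  proof -
    have xyR: "x \<in> R" "y \<in> R" using xy T by auto
    have ge: "2 * c \<le> z \<bullet> z" if "z \<in> R" for z
      using that short_inner long_inner pos by (auto simp: R_eq)
    have "\<not> (x \<bullet> y = 0 \<and> (\<forall>i\<in>I. x \<bullet> \<epsilon> i = 0 \<or> y \<bullet> \<epsilon> i = 0))"
    proof
      assume o: "x \<bullet> y = 0 \<and> (\<forall>i\<in>I. x \<bullet> \<epsilon> i = 0 \<or> y \<bullet> \<epsilon> i = 0)"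
      then have x: "x \<bullet> (x + y) = x \<bullet> x" and y: "y \<bullet> (x + y) = y \<bullet> y"
        by (simp_all add: inner_add_right inner_commute)
      have "(x + y) \<bullet> (x + y) = x \<bullet> x + y \<bullet> y"
        using o by (simp add: inner_add_right inner_add_left inner_commute)
      then have "x + y \<in> Clo"
        using R ge[OF xyR(1)] ge[OF xyR(2)] short_inner pos by (fastforce simp: R_eq)
      then obtain s i where s: "i \<in> I" "x + y = s *\<^sub>R \<epsilon> i"
        by (rule longE)
      have "x \<bullet> x = s * (x \<bullet> \<epsilon> i)" "y \<bullet> y = s * (y \<bullet> \<epsilon> i)"
        using x y by (simp_all add: s(2))
      then have "x \<bullet> x = 0 \<or> y \<bullet> y = 0"
        using o s(1) by auto
      then show False
        using ge[OF xyR(1)] ge[OF xyR(2)] pos by auto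
    qed
    moreover have "(x + y) \<bullet> \<epsilon> i = 0" if "x \<bullet> \<epsilon> i = 0" "y \<bullet> \<epsilon> i = 0" for i
      using that by (simp add: inner_add_left)
    ultimately show ?thesis
      using split[OF xy] R unfolding T by blast
  qed
  then show "closed_in R T"
    by (simp add: closed_in_def)
qed

text \<open>If \<open>2\<epsilon>\<^sub>p \<notin> U\<close>, the witness \<open>T\<close> is the subsystem of type
  \<open>C\<^sub>k \<times> C\<^bsub>n-k\<^esub>\<close> that splits off the coordinates linked to \<open>p\<close> by \<open>U\<close>.\<close>

lemma C_nonclosed:
  assumes refl_R: "\<And>\<alpha> \<beta>. \<alpha> \<in> R \<Longrightarrow> \<beta> \<in> R \<Longrightarrow> refl_root \<alpha> \<beta> \<in> R"
    and U: "U \<subseteq> R" "\<And>\<alpha> \<beta>. \<alpha> \<in> U \<Longrightarrow> \<beta> \<in> U \<Longrightarrow> refl_root \<alpha> \<beta> \<in> U"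
    and ab: "\<alpha> \<in> U" "\<beta> \<in> U" "\<alpha> \<in> Csh" "\<beta> \<in> Csh" "\<alpha> + \<beta> \<in> Clo - U"
  shows "U = Csh \<or>
    (\<exists>T. U \<subset> T \<and> T \<subset> R \<and> (\<forall>\<alpha>\<in>T. \<forall>\<beta>\<in>T. refl_root \<alpha> \<beta> \<in> T) \<and> closed_in R T)"
proof -
  have negU: "- x \<in> U" if "x \<in> U" for x
    using U(2)[OF that that] by simp
  have "\<alpha> + \<beta> \<in> Clo" using ab(5) by blast
  then obtain z p where z: "z = -2 \<or> z = 2" "p \<in> I" "\<alpha> + \<beta> = z *\<^sub>R \<epsilon> p"
    by (rule longE)
  have long_p: "2 *\<^sub>R \<epsilon> p \<notin> U" "(-2) *\<^sub>R \<epsilon> p \<notin> U"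
    using ab(5) z negU[of "2 *\<^sub>R \<epsilon> p"] negU[of "(-2) *\<^sub>R \<epsilon> p"] by auto
  obtain s t i j where a: "s = -1 \<or> s = 1" "t = -1 \<or> t = 1" "i \<in> I" "j \<in> I" "i \<noteq> j"
    "\<alpha> = s *\<^sub>R \<epsilon> i + t *\<^sub>R \<epsilon> j"
    using ab(3) by (rule shortE)
  \<comment> \<open>Comparing squared lengths shows that p is an index of \<alpha>, occurring with
    the sign of z.\<close>
  have "\<beta> = - (\<alpha> - z *\<^sub>R \<epsilon> p)"
    by (simp flip: z(3))
  then have "\<beta> \<bullet> \<beta> = (\<alpha> - z *\<^sub>R \<epsilon> p) \<bullet> (\<alpha> - z *\<^sub>R \<epsilon> p)"
    by (simp only: inner_minus_left inner_minus_right minus_minus)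
  also have "\<dots> = 2 * c - z * (2 * (\<alpha> \<bullet> \<epsilon> p)) + 4 * c"
    unfolding inner_diff_scaleR_self using z(1,2) short_inner[OF ab(3)] by (auto simp: orth)
  finally have zp: "z * (\<alpha> \<bullet> \<epsilon> p) = 2 * c"
    using short_inner[OF ab(4)] by simp
  have pq: "\<exists>q\<in>I. q \<noteq> p \<and> \<epsilon> p + \<epsilon> q \<in> U \<and> \<epsilon> p - \<epsilon> q \<in> U"
    if a: "s = -1 \<or> s = 1" "t = -1 \<or> t = 1" "j \<in> I" "p \<noteq> j" "\<alpha> = s *\<^sub>R \<epsilon> p + t *\<^sub>R \<epsilon> j" for s t j
  proof -
    have "z * s * c = 2 * c"
      using zp z(2) a by (simp add: inner_add_left orth)
    then have zs: "z * s = 2" using pos by simp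
    have b: "\<beta> = s *\<^sub>R \<epsilon> p - t *\<^sub>R \<epsilon> j"
    proof -
      have "\<beta> = z *\<^sub>R \<epsilon> p - \<alpha>"
        using z(3) by (metis add_diff_cancel_left')
      moreover have "z = 2 * s" using zs a(1) z(1) by auto
      ultimately show ?thesis by (simp add: a(5) scaleR_2 flip: scaleR_scaleR)
    qed
    have "\<epsilon> p + \<epsilon> j \<in> U \<and> \<epsilon> p - \<epsilon> j \<in> U"
      using ab(1,2) negU[OF ab(1)] negU[OF ab(2)] a(1,2) unfolding b a(5) by (elim disjE) (auto simp: add.commute)
    then show ?thesis
      by (intro bexI[of _ j]) (use a in auto)
  qed
  have "p = i \<or> p = j"
  proof (rule ccontr)
    assume "\<not> (p = i \<or> p = j)"
    then have "\<alpha> \<bullet> \<epsilon> p = 0"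
      using a(3,4) z(2) by (auto simp: a(6) inner_add_left orth)
    then show False using zp pos by simp
  qed
  then obtain q where q: "q \<in> I" "q \<noteq> p" "\<epsilon> p + \<epsilon> q \<in> U" "\<epsilon> p - \<epsilon> q \<in> U"
  proof
    assume "p = i"
    then show ?thesis using that pq[OF a(1,2,4)] a by auto
  next
    assume "p = j"
    then show ?thesis using that pq[OF a(2,1,3)] a by (auto simp: add.commute)
  qed
  have pshort: "\<epsilon> p + r *\<^sub>R \<epsilon> i \<in> Csh" if "r = -1 \<or> r = 1" "i \<in> I" "i \<noteq> p" for r i
    using that z(2) by (intro shortI[of 1 r p i]) auto
  \<comment> \<open>The reflections in \<epsilon> p - \<epsilon> q and \<epsilon> p + \<epsilon> q
    together negate the coordinates p and q. Followed by negation this changes the sign at i, so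
    being linked to p does not depend on the sign.\<close>
  have flip: "\<epsilon> p + (- r) *\<^sub>R \<epsilon> i \<in> U"
    if "\<epsilon> p + r *\<^sub>R \<epsilon> i \<in> U" "r = -1 \<or> r = 1" "i \<in> I" "i \<noteq> p" for r i
  proof (cases "i = q")
    case True
    then show ?thesis using q that by auto
  next
    case False
    have "refl_root (\<epsilon> p - \<epsilon> q) (\<epsilon> p + r *\<^sub>R \<epsilon> i) = (\<epsilon> p + r *\<^sub>R \<epsilon> i) - 1 *\<^sub>R (\<epsilon> p - \<epsilon> q)"
      using pshort[of "-1" q] False that q z(2)
      by (intro refl_short) (auto simp: inner_add_left inner_diff_right orth)
    then have 1: "\<epsilon> q + r *\<^sub>R \<epsilon> i \<in> U"
      using U(2)[OF q(4) that(1)] by (simp add: algebra_simps)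
    have "refl_root (\<epsilon> p + \<epsilon> q) (\<epsilon> q + r *\<^sub>R \<epsilon> i) = (\<epsilon> q + r *\<^sub>R \<epsilon> i) - 1 *\<^sub>R (\<epsilon> p + \<epsilon> q)"
      using pshort[of 1 q] False that q z(2)
      by (intro refl_short) (auto simp: inner_add_left inner_add_right orth)
    then have "- \<epsilon> p + r *\<^sub>R \<epsilon> i \<in> U"
      using U(2)[OF q(3) 1] by simp
    from negU[OF this] show ?thesis by simp
  qed
  define J where "J = {i \<in> I. i = p \<or> \<epsilon> p + \<epsilon> i \<in> U}"
  have JU: "\<epsilon> p + r *\<^sub>R \<epsilon> i \<in> U" if "i \<in> J" "i \<noteq> p" "r = -1 \<or> r = 1" for r i
    using that flip[of 1 i] by (auto simp: J_def)
  have UJ: "i \<in> J" if "\<epsilon> p + r *\<^sub>R \<epsilon> i \<in> U" "r = -1 \<or> r = 1" "i \<in> I" for r i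
    using that flip[of r i] by (cases "i = p") (auto simp: J_def)
  \<comment> \<open>The reflection in \<epsilon> p - s \<epsilon> i replaces the term s \<epsilon> i
    by \<epsilon> p; it moves short roots between the index pairs {i, j} and {p, j}.\<close>
  have swap: "refl_root (\<epsilon> p + (- s) *\<^sub>R \<epsilon> i) (s *\<^sub>R \<epsilon> i + t *\<^sub>R \<epsilon> j) = \<epsilon> p + t *\<^sub>R \<epsilon> j"
    "refl_root (\<epsilon> p + (- s) *\<^sub>R \<epsilon> i) (\<epsilon> p + t *\<^sub>R \<epsilon> j) = s *\<^sub>R \<epsilon> i + t *\<^sub>R \<epsilon> j"
    if st: "s = -1 \<or> s = 1" "t = -1 \<or> t = 1" and ij: "i \<in> I" "j \<in> I" "i \<noteq> j" "i \<noteq> p" "j \<noteq> p" for s t i j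
  proof -
    have sh: "\<epsilon> p + (- s) *\<^sub>R \<epsilon> i \<in> Csh"
      using st ij by (intro pshort) auto
    have "(s *\<^sub>R \<epsilon> i + t *\<^sub>R \<epsilon> j) \<bullet> (\<epsilon> p + (- s) *\<^sub>R \<epsilon> i) = (-1) * c"
      using st ij z(2) by (auto simp: inner_add_left inner_diff_right orth inner_add_right)
    from refl_short[OF sh this]
    show 1: "refl_root (\<epsilon> p + (- s) *\<^sub>R \<epsilon> i) (s *\<^sub>R \<epsilon> i + t *\<^sub>R \<epsilon> j) = \<epsilon> p + t *\<^sub>R \<epsilon> j"
      by simp
    show "refl_root (\<epsilon> p + (- s) *\<^sub>R \<epsilon> i) (\<epsilon> p + t *\<^sub>R \<epsilon> j) = s *\<^sub>R \<epsilon> i + t *\<^sub>R \<epsilon> j"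
      using refl_root_invol 1 by metis
  qed
  show ?thesis
  proof (cases "J = I")
    case True
    have p_in: "s *\<^sub>R \<epsilon> p + t *\<^sub>R \<epsilon> i \<in> U" if st: "s = -1 \<or> s = 1" "t = -1 \<or> t = 1" and i: "i \<in> I" "i \<noteq> p" for s t i
      using st(1)
    proof
      assume s: "s = -1"
      have "- t = -1 \<or> - t = 1" using st(2) by auto
      then have "\<epsilon> p + (- t) *\<^sub>R \<epsilon> i \<in> U" using JU True i by blast
      from negU[OF this] show ?thesis by (simp add: s)
    qed (use JU True st i in auto)
    have "x \<in> U" if "x \<in> Csh" for x
      using that
    proof (rule shortE)
      fix s t i j
      assume st: "s = -1 \<or> s = 1" "t = -1 \<or> t = 1" and ij: "i \<in> I" "j \<in> I" "i \<noteq> j"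
        and x: "x = s *\<^sub>R \<epsilon> i + t *\<^sub>R \<epsilon> j"
      consider "i = p" | "j = p" | "i \<noteq> p" "j \<noteq> p" by blast
      then show "x \<in> U"
      proof cases
        case 1
        then show ?thesis using p_in[OF st, of j] ij x by simp
      next
        case 2
        then show ?thesis using p_in[OF st(2,1), of i] ij x by (simp add: add.commute)
      next
        case 3
        have "- s = -1 \<or> - s = 1" using st(1) by auto
        then show ?thesis
          using U(2)[OF JU JU[OF _ 3(2) st(2)], of i "- s"] swap(2)[OF st ij 3] True ij 3 x by simp
      qed
    qed
    \<comment> \<open>A long root at an index other than p is carried to 2 \<epsilon> p by a short
      reflection from U, which \<open>long_p\<close> excludes.\<close>
    moreover have "x \<notin> U" if xl: "x \<in> Clo" for x
    proof
      assume xU: "x \<in> U"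
      obtain y i where y: "y = -2 \<or> y = 2" "i \<in> I" "x = y *\<^sub>R \<epsilon> i"
        using xl by (rule longE)
      show False
      proof (cases "i = p")
        case True
        then show False using y xU long_p by auto
      next
        case False
        have r: "- (y / 2) = -1 \<or> - (y / 2) = 1" using y(1) by auto
        have "x \<bullet> (\<epsilon> p + (- (y / 2)) *\<^sub>R \<epsilon> i) = (-2) * c"
          using y False z(2) by (auto simp: inner_add_right inner_diff_right orth)
        from refl_short[OF pshort[OF r y(2) False] this]
        have "refl_root (\<epsilon> p + (- (y / 2)) *\<^sub>R \<epsilon> i) x = 2 *\<^sub>R \<epsilon> p"
          by (simp add: y(3) algebra_simps)
        then show False
          using U(2)[OF JU[OF _ False r] xU] True y(2) long_p by simp
      qed
    qed
    ultimately have "U = Csh"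
      using U(1) R_eq by blast
    then show ?thesis ..
  next
    case False
    define T where "T = {x \<in> R. (\<forall>i\<in>J. x \<bullet> \<epsilon> i = 0) \<or> (\<forall>i\<in>I - J. x \<bullet> \<epsilon> i = 0)}"
    have JI: "J \<subseteq> I" "p \<in> J" using z(2) by (auto simp: J_def)
    \<comment> \<open>Moving the index i to p by \<open>swap\<close> would link j to p, hence put j
      into J.\<close>
    have no_mix: "\<not> (s *\<^sub>R \<epsilon> i + t *\<^sub>R \<epsilon> j \<in> U)"
      if st: "s = -1 \<or> s = 1" "t = -1 \<or> t = 1" and ij: "i \<in> J" "j \<in> I - J" for s t i j
    proof
      assume x: "s *\<^sub>R \<epsilon> i + t *\<^sub>R \<epsilon> j \<in> U"
      have "\<exists>r. (r = -1 \<or> r = 1) \<and> \<epsilon> p + r *\<^sub>R \<epsilon> j \<in> U"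
      proof (cases "i = p")
        case True
        show ?thesis
        proof (cases "s = 1")
          case True
          then show ?thesis using x \<open>i = p\<close> st(2) by auto
        next
          case False
          have "\<epsilon> p + (- t) *\<^sub>R \<epsilon> j \<in> U"
            using negU[OF x] False st(1) \<open>i = p\<close> by simp
          moreover have "- t = -1 \<or> - t = 1" using st(2) by auto
          ultimately show ?thesis by blast
        qed
      next
        case False
        have s': "- s = -1 \<or> - s = 1" using st(1) by auto
        have "i \<in> I" "j \<in> I" "i \<noteq> j" "j \<noteq> p" using ij JI by auto
        then have "\<epsilon> p + t *\<^sub>R \<epsilon> j \<in> U"
          using U(2)[OF JU[OF ij(1) False s'] x] swap(1)[OF st _ _ _ False, of j] by simp
        then show ?thesis using st(2) by blast
      qed
      then show False using UJ[of _ j] ij(2) by blast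
    qed
    have "x \<in> T" if xU: "x \<in> U" for x
    proof -
      consider "x \<in> Csh" | "x \<in> Clo" using xU U(1) R_eq by blast
      then show ?thesis
      proof cases
        case 1
        then obtain s t i j where b: "s = -1 \<or> s = 1" "t = -1 \<or> t = 1" "i \<in> I" "j \<in> I" "i \<noteq> j"
          "x = s *\<^sub>R \<epsilon> i + t *\<^sub>R \<epsilon> j"
          by (rule shortE)
        have "s *\<^sub>R \<epsilon> i + t *\<^sub>R \<epsilon> j \<in> U" "t *\<^sub>R \<epsilon> j + s *\<^sub>R \<epsilon> i \<in> U"
          using xU b(6) by (simp_all add: add.commute)
        then have "i \<in> J \<longleftrightarrow> j \<in> J"
          using no_mix[OF b(1,2), of i j] no_mix[OF b(2,1), of j i] b(3,4) by blast
        moreover have "x \<bullet> \<epsilon> k = 0" if "k \<in> I" "k \<noteq> i" "k \<noteq> j" for k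
          using that b(3,4) by (auto simp: b(6) inner_add_left orth)
        ultimately have "(\<forall>k\<in>J. x \<bullet> \<epsilon> k = 0) \<or> (\<forall>k\<in>I - J. x \<bullet> \<epsilon> k = 0)"
          using JI(1) b(3,4) by blast
        then show ?thesis
          using U(1) xU by (auto simp: T_def)
      next
        case 2
        then obtain y i where b: "y = -2 \<or> y = 2" "i \<in> I" "x = y *\<^sub>R \<epsilon> i"
          by (rule longE)
        have "x \<bullet> \<epsilon> k = 0" if "k \<in> I" "k \<noteq> i" for k
          using that b(2) by (auto simp: b(3) orth)
        then have "(\<forall>k\<in>J. x \<bullet> \<epsilon> k = 0) \<or> (\<forall>k\<in>I - J. x \<bullet> \<epsilon> k = 0)"
          using JI(1) b(2) by blast
        then show ?thesis
          using U(1) xU by (auto simp: T_def)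
      qed
    qed
    moreover have "2 *\<^sub>R \<epsilon> p \<in> T"
    proof -
      have "\<forall>i\<in>I - J. \<epsilon> p \<bullet> \<epsilon> i = 0"
        using JI z(2) by (auto simp: orth)
      then show ?thesis
        using longI[of 2 p, OF _ z(2) refl] R_eq by (simp add: T_def)
    qed
    ultimately have "U \<subset> T"
      using long_p by blast
    \<comment> \<open>For k outside J the root \<epsilon> p + \<epsilon> k is supported on neither
      side.\<close>
    moreover have "T \<subset> R"
    proof -
      obtain k where k: "k \<in> I - J" using False JI by blast
      have "\<epsilon> p + 1 *\<^sub>R \<epsilon> k \<in> R"
        using pshort[of 1 k] k JI R_eq by auto
      moreover have "k \<in> I" "k \<noteq> p" using k JI by auto
      then have "(\<epsilon> p + 1 *\<^sub>R \<epsilon> k) \<bullet> \<epsilon> p \<noteq> 0" "(\<epsilon> p + 1 *\<^sub>R \<epsilon> k) \<bullet> \<epsilon> k \<noteq> 0"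
        using z(2) pos by (simp_all add: inner_add_left orth)
      then have "\<epsilon> p + 1 *\<^sub>R \<epsilon> k \<notin> T"
        using k JI unfolding T_def by blast
      ultimately show ?thesis unfolding T_def by blast
    qed
    ultimately show ?thesis
      using split_closed[OF refl_R T_def] by blast
  qed
qed

lemma C_affine_two_lengths:
  fixes Y :: "'b::real_vector set" and \<Lambda> :: "'a \<Rightarrow> 'b set"
  assumes "finite_root_system R" "extension_datum R Y \<Lambda>"
  shows "affine_two_lengths R Y \<Lambda> 2"
proof (unfold_locales, unfold short_roots_eq long_roots_eq)
  fix Z :: "'a \<Rightarrow> 'b set"
  assume Z: "\<And>\<alpha>. \<alpha> \<in> Csh \<Longrightarrow> Z \<alpha> \<noteq> {}"
    "\<And>\<alpha> y. \<alpha> \<in> Csh \<Longrightarrow> y \<in> Z \<alpha> \<Longrightarrow> - y \<in> Z (- \<alpha>)"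
    "\<And>\<alpha> \<beta> y z. \<alpha> \<in> Csh \<Longrightarrow> \<beta> \<in> Csh \<Longrightarrow> \<alpha> + \<beta> \<in> Csh \<Longrightarrow> y \<in> Z \<alpha> \<Longrightarrow> z \<in> Z \<beta> \<Longrightarrow>
      y + z \<in> Z (\<alpha> + \<beta>)"
  show "\<exists>L. linear L \<and> (\<forall>\<alpha>\<in>Csh. L \<alpha> \<in> Z \<alpha>)"
    by (rule C_lift) (fact Z)+
next
  fix U \<alpha> \<beta>
  assume U: "U \<subseteq> R" "\<And>\<alpha> \<beta>. \<alpha> \<in> U \<Longrightarrow> \<beta> \<in> U \<Longrightarrow> refl_root \<alpha> \<beta> \<in> U"
    and ab: "\<alpha> \<in> U" "\<beta> \<in> U" "\<alpha> \<in> Csh" "\<beta> \<in> Csh" "\<alpha> + \<beta> \<in> Clo - U"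
  have "refl_root \<alpha> \<beta> \<in> R" if "\<alpha> \<in> R" "\<beta> \<in> R" for \<alpha> \<beta>
    using assms(1) that unfolding finite_root_system_def by blast
  then show "U = Csh \<or>
      (\<exists>T. U \<subset> T \<and> T \<subset> R \<and> (\<forall>\<alpha>\<in>T. \<forall>\<beta>\<in>T. refl_root \<alpha> \<beta> \<in> T) \<and> closed_in R T)"
    using C_nonclosed[OF _ U ab] by blast
next
  show "finite_root_system R" "extension_datum R Y \<Lambda>" by (fact assms)+
  show "(2::nat) = 2 \<or> (2::nat) = 3" by simp
  show "R \<subseteq> Csh \<union> Clo" by (simp add: R_eq)
  show "Clo \<noteq> {}" by (fact ex_long)
next
  fix \<alpha> \<gamma> assume "\<alpha> \<in> Csh" "\<gamma> \<in> Clo"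
  then show "\<gamma> \<bullet> \<gamma> = real 2 * (\<alpha> \<bullet> \<alpha>)" by (simp add: short_inner long_inner)
next
  fix \<gamma> assume "\<gamma> \<in> Clo"
  then show "\<exists>\<alpha>\<in>Csh. \<exists>\<beta>\<in>Csh. \<gamma> = \<alpha> + \<beta>" by (rule C_long_sum)
next
  fix \<alpha> \<beta> assume "\<alpha> \<in> Csh" "\<beta> \<in> Csh"
  then show "\<exists>\<delta>\<in>Csh. (\<delta> - \<alpha> \<in> Csh \<or> \<delta> + \<alpha> \<in> Csh) \<and> (\<delta> - \<beta> \<in> Csh \<or> \<delta> + \<beta> \<in> Csh)"
    by (rule C_neighbour)
next
  fix \<gamma> \<gamma>' assume "\<gamma> \<in> Clo" "\<gamma>' \<in> Clo"
  then show "\<exists>\<delta>\<in>Csh. \<exists>k. \<gamma>' - k *\<^sub>R \<delta> \<in> {\<gamma>, - \<gamma>}"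
    by (rule C_long_translate)
qed

end


section \<open>Type \<open>G\<^sub>2\<close>\<close>

definition G2_short :: "(3 \<Rightarrow> 'a::euclidean_space) \<Rightarrow> 'a set" where
  "G2_short a = {x. \<exists>i. x = a i \<or> x = - a i}"

definition G2_long :: "(3 \<Rightarrow> 'a::euclidean_space) \<Rightarrow> 'a set" where
  "G2_long a = {a i - a j | i j. i \<noteq> j}"

text \<open>Three short roots at mutual angles of 120 degrees, with sum zero. Unlike a pair of
  simple roots they are permuted freely, and the long roots are exactly their differences.\<close>

locale G2_roots =
  fixes a :: "3 \<Rightarrow> 'a::euclidean_space" and c :: real and R :: "'a set"
  assumes pos: "0 < c"
    and inner_a: "a i \<bullet> a j = (if i = j then c else - c / 2)"
    and sum_a: "i \<noteq> j \<Longrightarrow> k \<noteq> i \<Longrightarrow> k \<noteq> j \<Longrightarrow> a k = - (a i + a j)"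
    and R_eq: "R = G2_short a \<union> G2_long a"
begin

abbreviation "Gsh \<equiv> G2_short a"
abbreviation "Glo \<equiv> G2_long a"

lemma short_iff: "x \<in> Gsh \<longleftrightarrow> (\<exists>i. x = a i \<or> x = - a i)"
  by (simp add: G2_short_def)

lemma long_iff: "x \<in> Glo \<longleftrightarrow> (\<exists>i j. i \<noteq> j \<and> x = a i - a j)"
  by (auto simp: G2_long_def)

lemma third: "\<exists>k::3. k \<noteq> i \<and> k \<noteq> j"
  using exhaust_3[of i] exhaust_3[of j] by (auto intro: exI[of _ 1] exI[of _ 2] exI[of _ 3])

lemma three_cases: "i \<noteq> j \<Longrightarrow> k \<noteq> i \<Longrightarrow> k \<noteq> j \<Longrightarrow> l = i \<or> l = j \<or> l = (k::3)"
  using exhaust_3[of i] exhaust_3[of j] exhaust_3[of k] exhaust_3[of l] by auto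

lemma short_inner: "x \<in> Gsh \<Longrightarrow> x \<bullet> x = c"
  unfolding short_iff by (auto simp: inner_a)

lemma long_inner: "x \<in> Glo \<Longrightarrow> x \<bullet> x = 3 * c"
  unfolding long_iff by (auto simp: inner_diff_left inner_diff_right inner_a)

lemma ex_short: "Gsh \<noteq> {}" and ex_long: "Glo \<noteq> {}"
proof -
  have "a 1 \<in> Gsh" unfolding short_iff by blast
  then show "Gsh \<noteq> {}" by blast
  obtain k :: 3 where "k \<noteq> 1" using third by blast
  then have "a k - a 1 \<in> Glo" unfolding long_iff by blast
  then show "Glo \<noteq> {}" by blast
qed

lemma short_roots_eq: "short_roots R = Gsh"
proof -
  obtain y where "y \<in> Gsh" using ex_short by blast
  then show ?thesis
    using pos short_inner long_inner unfolding short_roots_def R_eq norm_le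
    by (force simp: norm_le)
qed

lemma long_roots_eq: "long_roots R = Glo"
proof -
  obtain y where "y \<in> Glo" using ex_long by blast
  then show ?thesis
    using pos short_inner long_inner unfolding long_roots_def R_eq norm_le
    by (force simp: norm_le)
qed

lemma refl_a: "refl_root (a i) x = x - (2 * (x \<bullet> a i) / c) *\<^sub>R a i"
  by (simp add: refl_root_def inner_coroot inner_a)

text \<open>For k distinct from l the sum a k + a l is the negative of the third vector. So a k is a
  common neighbour as soon as k avoids the indices of both roots.\<close>

lemma G2_neighbour:
  assumes "\<alpha> \<in> Gsh" "\<beta> \<in> Gsh"
  shows "\<exists>\<delta>\<in>Gsh. (\<delta> - \<alpha> \<in> Gsh \<or> \<delta> + \<alpha> \<in> Gsh) \<and> (\<delta> - \<beta> \<in> Gsh \<or> \<delta> + \<beta> \<in> Gsh)"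
proof -
  obtain i j where i: "\<alpha> = a i \<or> \<alpha> = - a i" and j: "\<beta> = a j \<or> \<beta> = - a j"
    using assms unfolding short_iff by blast
  obtain k where k: "k \<noteq> i" "k \<noteq> j" using third by blast
  have "a k + a l \<in> Gsh" if "k \<noteq> l" for l
  proof -
    obtain h where "h \<noteq> k" "h \<noteq> l" using third by blast
    then have "a k + a l = - a h" using sum_a[OF that] by simp
    then show ?thesis unfolding short_iff by blast
  qed
  then have "a k + a i \<in> Gsh" "a k + a j \<in> Gsh" using k by auto
  moreover have "a k \<in> Gsh" unfolding short_iff by blast
  ultimately show ?thesis
    using i j by (intro bexI[of _ "a k"]) (elim disjE; simp)+
qed

lemma G2_long_translate:
  assumes "\<gamma> \<in> Glo" "\<gamma>' \<in> Glo"
  shows "\<exists>\<delta>\<in>Gsh. \<exists>k. \<gamma>' - k *\<^sub>R \<delta> \<in> {\<gamma>, - \<gamma>}"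
proof -
  have short: "a x \<in> Gsh" for x unfolding short_iff by blast
  obtain i j where i: "\<gamma> = a i - a j" "i \<noteq> j" using assms(1) unfolding long_iff by blast
  obtain k where k: "k \<noteq> i" "k \<noteq> j" using third by blast
  obtain u v where u: "\<gamma>' = a u - a v" "u \<noteq> v" using assms(2) unfolding long_iff by blast
  have ak: "a k = - (a i + a j)" using sum_a[OF i(2) k] .
  have 3: "x + (x + x) = 3 *\<^sub>R x" for x :: 'a
    using scaleR_left_distrib[of 1 2 x] by (simp add: scaleR_2)
  \<comment> \<open>A long root other than \<gamma> and -\<gamma> has Cartan integer 3 or -3 at a i
    or a j, and the corresponding reflection sends it to \<gamma> or -\<gamma>.\<close>
  have "\<gamma>' - 0 *\<^sub>R a i \<in> {\<gamma>, - \<gamma>} \<or> \<gamma>' - 3 *\<^sub>R a i \<in> {\<gamma>, - \<gamma>} \<or> \<gamma>' - 3 *\<^sub>R a j \<in> {\<gamma>, - \<gamma>} \<or>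
    \<gamma>' - (-3) *\<^sub>R a i \<in> {\<gamma>, - \<gamma>} \<or> \<gamma>' - (-3) *\<^sub>R a j \<in> {\<gamma>, - \<gamma>}"
    using three_cases[OF i(2) k, of u] three_cases[OF i(2) k, of v] u(2)
    unfolding u(1) i(1) by (elim disjE) (simp_all add: ak algebra_simps flip: 3)
  then show ?thesis using short by blast
qed

text \<open>The coefficient functionals of \<open>L\<close> are the basis dual to \<open>a 1\<close>, \<open>a 2\<close>.\<close>

lemma G2_lift:
  fixes Z :: "'a \<Rightarrow> 'b::real_vector set"
  assumes ne: "\<And>\<alpha>. \<alpha> \<in> Gsh \<Longrightarrow> Z \<alpha> \<noteq> {}"
    and neg: "\<And>\<alpha> y. \<alpha> \<in> Gsh \<Longrightarrow> y \<in> Z \<alpha> \<Longrightarrow> - y \<in> Z (- \<alpha>)"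
    and add: "\<And>\<alpha> \<beta> y z. \<alpha> \<in> Gsh \<Longrightarrow> \<beta> \<in> Gsh \<Longrightarrow> \<alpha> + \<beta> \<in> Gsh \<Longrightarrow> y \<in> Z \<alpha> \<Longrightarrow> z \<in> Z \<beta> \<Longrightarrow>
      y + z \<in> Z (\<alpha> + \<beta>)"
  shows "\<exists>L. linear L \<and> (\<forall>\<alpha>\<in>Gsh. L \<alpha> \<in> Z \<alpha>)"
proof -
  have short: "a x \<in> Gsh" "- a x \<in> Gsh" for x unfolding short_iff by blast+
  obtain u1 u2 where u: "u1 \<in> Z (a 1)" "u2 \<in> Z (a 2)" using ne short by blast
  define L where "L v = ((4 / (3 * c)) * (v \<bullet> a 1 + v \<bullet> a 2 / 2)) *\<^sub>R u1 +
    ((4 / (3 * c)) * (v \<bullet> a 2 + v \<bullet> a 1 / 2)) *\<^sub>R u2" for v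
  have lin: "linear L"
    by (rule linearI) (simp_all add: L_def inner_add_left algebra_simps add_divide_distrib)
  have L1: "L (a 1) = u1" and L2: "L (a 2) = u2"
    using pos by (simp_all add: L_def inner_a)
  have a3: "a 3 = - (a 1 + a 2)" by (rule sum_a) auto
  then have "a 1 + a 2 \<in> Gsh" using short(2)[of 3] by (simp add: add.commute)
  then have "u1 + u2 \<in> Z (a 1 + a 2)" using add[OF short(1) short(1) _ u] by simp
  then have "L (a 3) \<in> Z (a 3)"
    using neg[OF \<open>a 1 + a 2 \<in> Gsh\<close>] unfolding a3 linear_neg[OF lin] linear_add[OF lin] L1 L2 by blast
  then have *: "L (a i) \<in> Z (a i)" for i
    using exhaust_3[of i] u L1 L2 by auto
  have "L \<alpha> \<in> Z \<alpha>" if "\<alpha> \<in> Gsh" for \<alpha>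
  proof -
    from that obtain i where "\<alpha> = a i \<or> \<alpha> = - a i" unfolding short_iff by blast
    then show ?thesis
      using * neg[OF short(1) *] by (auto simp: linear_neg[OF lin])
  qed
  then show ?thesis using lin by blast
qed

text \<open>Two short roots with long sum generate all short roots by reflections. A single long
  root in U would then generate all six, including the missing sum.\<close>

lemma G2_nonclosed:
  assumes U: "U \<subseteq> R" "\<And>\<alpha> \<beta>. \<alpha> \<in> U \<Longrightarrow> \<beta> \<in> U \<Longrightarrow> refl_root \<alpha> \<beta> \<in> U"
    and ab: "\<alpha> \<in> U" "\<beta> \<in> U" "\<alpha> \<in> Gsh" "\<beta> \<in> Gsh" "\<alpha> + \<beta> \<in> Glo - U"
  shows "U = Gsh"
proof -
  have negU: "- x \<in> U" if "x \<in> U" for x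
    using U(2)[OF that that] by simp
  have negU_iff: "- x \<in> U \<longleftrightarrow> x \<in> U" for x
    using negU[of x] negU[of "- x"] by auto
  obtain i j where i: "\<alpha> = a i \<or> \<alpha> = - a i" and j: "\<beta> = a j \<or> \<beta> = - a j"
    using ab(3,4) unfolding short_iff by blast
  have "(\<alpha> + \<beta>) \<bullet> (\<alpha> + \<beta>) = 3 * c"
    using ab(5) long_inner by blast
  \<comment> \<open>Among the sums of two short roots only the differences of distinct a i and a j
    have squared length 3c.\<close>
  then have ij: "i \<noteq> j" and op: "\<alpha> = a i \<and> \<beta> = - a j \<or> \<alpha> = - a i \<and> \<beta> = a j"
    using i j pos by (auto simp: inner_add_left inner_add_right inner_diff_left inner_diff_right inner_a
        split: if_splits)
  have aU: "a i \<in> U" "a j \<in> U"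
    using op ab(1,2) by (auto simp: negU_iff)
  have "a i - a j \<notin> U"
    using op ab(5) negU[of "a i - a j"] by auto
  obtain k where k: "k \<noteq> i" "k \<noteq> j" using third by blast
  have "refl_root (a i) (a j) = - a k"
    using pos ij sum_a[OF ij k] by (simp add: refl_a inner_a)
  then have "a k \<in> U"
    using U(2)[OF aU] negU_iff by metis
  then have all: "a l \<in> U" for l
    using three_cases[OF ij k, of l] aU by blast
  \<comment> \<open>The reflection in a x cycles the three differences; two uses together with
    negation give all long roots.\<close>
  have rot: "a z - a x \<in> U" if "a x - a y \<in> U" "x \<noteq> y" "z \<noteq> x" "z \<noteq> y" for x y z
  proof -
    have "(a x - a y) \<bullet> a x = 3 / 2 * c"
      using that(2) by (simp add: inner_diff_left inner_a)
    then have "refl_root (a x) (a x - a y) = (a x - a y) - 3 *\<^sub>R a x"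
      using pos by (simp add: refl_a nonzero_divide_eq_eq)
    also have "\<dots> = a z - a x"
      using scaleR_left_distrib[of 1 2 "a x"] by (simp add: sum_a[OF that(2-4)] scaleR_2)
    finally show ?thesis
      using U(2)[OF all that(1)] by metis
  qed
  have "a x - a y \<notin> U" if xy: "x \<noteq> y" for x y
  proof
    assume 1: "a x - a y \<in> U"
    obtain z where z: "z \<noteq> x" "z \<noteq> y" using third by blast
    have 2: "a z - a x \<in> U" using rot[OF 1 xy z] .
    have 3: "a y - a z \<in> U" using rot[OF 2 z(1)] xy z by auto
    have "a i - a j \<in> U"
      using three_cases[OF xy z, of i] three_cases[OF xy z, of j] ij 1 2 3
        negU[OF 1] negU[OF 2] negU[OF 3] by auto
    then show False using \<open>a i - a j \<notin> U\<close> by blast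
  qed
  then have "U \<subseteq> Gsh"
    using U(1) unfolding R_eq subset_iff Un_iff long_iff by blast
  moreover have "Gsh \<subseteq> U"
    using all negU_iff unfolding subset_iff short_iff by blast
  ultimately show ?thesis by blast
qed

lemma G2_affine_two_lengths:
  fixes Y :: "'b::real_vector set" and \<Lambda> :: "'a \<Rightarrow> 'b set"
  assumes "finite_root_system R" "extension_datum R Y \<Lambda>"
  shows "affine_two_lengths R Y \<Lambda> 3"
proof (unfold_locales, unfold short_roots_eq long_roots_eq)
  fix Z :: "'a \<Rightarrow> 'b set"
  assume Z: "\<And>\<alpha>. \<alpha> \<in> Gsh \<Longrightarrow> Z \<alpha> \<noteq> {}"
    "\<And>\<alpha> y. \<alpha> \<in> Gsh \<Longrightarrow> y \<in> Z \<alpha> \<Longrightarrow> - y \<in> Z (- \<alpha>)"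
    "\<And>\<alpha> \<beta> y z. \<alpha> \<in> Gsh \<Longrightarrow> \<beta> \<in> Gsh \<Longrightarrow> \<alpha> + \<beta> \<in> Gsh \<Longrightarrow> y \<in> Z \<alpha> \<Longrightarrow> z \<in> Z \<beta> \<Longrightarrow>
      y + z \<in> Z (\<alpha> + \<beta>)"
  show "\<exists>L. linear L \<and> (\<forall>\<alpha>\<in>Gsh. L \<alpha> \<in> Z \<alpha>)"
    by (rule G2_lift) (fact Z)+
next
  fix U \<alpha> \<beta>
  assume U: "U \<subseteq> R" "\<And>\<alpha> \<beta>. \<alpha> \<in> U \<Longrightarrow> \<beta> \<in> U \<Longrightarrow> refl_root \<alpha> \<beta> \<in> U"
    and ab: "\<alpha> \<in> U" "\<beta> \<in> U" "\<alpha> \<in> Gsh" "\<beta> \<in> Gsh" "\<alpha> + \<beta> \<in> Glo - U"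
  show "U = Gsh \<or>
      (\<exists>T. U \<subset> T \<and> T \<subset> R \<and> (\<forall>\<alpha>\<in>T. \<forall>\<beta>\<in>T. refl_root \<alpha> \<beta> \<in> T) \<and> closed_in R T)"
    using G2_nonclosed[OF U ab] by (rule disjI1)
next
  show "finite_root_system R" "extension_datum R Y \<Lambda>" by (fact assms)+
  show "(3::nat) = 2 \<or> (3::nat) = 3" by simp
  show "R \<subseteq> Gsh \<union> Glo" by (simp add: R_eq)
  show "Glo \<noteq> {}" by (fact ex_long)
next
  fix \<alpha> \<gamma> assume "\<alpha> \<in> Gsh" "\<gamma> \<in> Glo"
  then show "\<gamma> \<bullet> \<gamma> = real 3 * (\<alpha> \<bullet> \<alpha>)" by (simp only: short_inner long_inner of_nat_numeral)
next
  fix \<gamma> assume "\<gamma> \<in> Glo"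
  then obtain i j where "\<gamma> = a i + - a j" unfolding long_iff by auto
  moreover have "a i \<in> Gsh" "- a j \<in> Gsh" unfolding short_iff by blast+
  ultimately show "\<exists>\<alpha>\<in>Gsh. \<exists>\<beta>\<in>Gsh. \<gamma> = \<alpha> + \<beta>" by blast
next
  fix \<alpha> \<beta> assume "\<alpha> \<in> Gsh" "\<beta> \<in> Gsh"
  then show "\<exists>\<delta>\<in>Gsh. (\<delta> - \<alpha> \<in> Gsh \<or> \<delta> + \<alpha> \<in> Gsh) \<and> (\<delta> - \<beta> \<in> Gsh \<or> \<delta> + \<beta> \<in> Gsh)"
    by (rule G2_neighbour)
next
  fix \<gamma> \<gamma>' assume "\<gamma> \<in> Glo" "\<gamma>' \<in> Glo"
  then show "\<exists>\<delta>\<in>Gsh. \<exists>k. \<gamma>' - k *\<^sub>R \<delta> \<in> {\<gamma>, - \<gamma>}"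
    by (rule G2_long_translate)
qed

end

section \<open>Translation to group quotients\<close>

lemma add_subgroup_group: "add_subgroup S \<Longrightarrow> comm_group (add_group_on S)"
proof (rule comm_groupI)
  assume S: "add_subgroup S"
  fix x assume "x \<in> carrier (add_group_on S)"
  then show "\<exists>y\<in>carrier (add_group_on S). y \<otimes>\<^bsub>add_group_on S\<^esub> x = \<one>\<^bsub>add_group_on S\<^esub>"
    using add_subgroup_minus[OF S] by (intro bexI[of _ "- x"]) (simp_all add: add_group_on_def)
qed (auto simp: add_group_on_def add_subgroup_plus algebra_simps, simp add: add_subgroup_def)

lemma add_subgroup_inv:
  assumes "add_subgroup S" "x \<in> S"
  shows "inv\<^bsub>add_group_on S\<^esub> x = - x"
proof -
  interpret comm_group "add_group_on S" using add_subgroup_group[OF assms(1)] .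
  show ?thesis
    by (rule inv_equality)
      (use assms add_subgroup_minus[OF assms] in \<open>simp_all add: add_group_on_def\<close>)
qed

lemma subgroup_add_group_on:
  assumes S: "add_subgroup S"
  shows "subgroup K (add_group_on S) \<longleftrightarrow> add_subgroup K \<and> K \<subseteq> S"
proof
  interpret comm_group "add_group_on S" using add_subgroup_group[OF S] .
  assume K: "subgroup K (add_group_on S)"
  have sub: "K \<subseteq> S"
    using subgroup.subset[OF K] by (simp add: add_group_on_def)
  have "x - y \<in> K" if "x \<in> K" "y \<in> K" for x y
  proof -
    have "- y \<in> K"
      using subgroup.m_inv_closed[OF K that(2)] add_subgroup_inv[OF S, of y] sub that by auto
    then show ?thesis
      using subgroup.m_closed[OF K that(1)] by (fastforce simp: add_group_on_def)
  qed
  then show "add_subgroup K \<and> K \<subseteq> S"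
    using subgroup.one_closed[OF K] sub by (simp add: add_subgroup_def add_group_on_def)
next
  interpret comm_group "add_group_on S" using add_subgroup_group[OF S] .
  assume K: "add_subgroup K \<and> K \<subseteq> S"
  show "subgroup K (add_group_on S)"
  proof (rule subgroupI)
    show "K \<subseteq> carrier (add_group_on S)" "K \<noteq> {}"
      using K by (auto simp: add_group_on_def add_subgroup_def)
  next
    fix x assume "x \<in> K"
    then show "inv\<^bsub>add_group_on S\<^esub> x \<in> K"
      using K add_subgroup_inv[OF S, of x] add_subgroup_minus[of K x] by auto
  next
    fix x y assume "x \<in> K" "y \<in> K"
    then show "x \<otimes>\<^bsub>add_group_on S\<^esub> y \<in> K"
      using K add_subgroup_plus[of K x y] by (simp add: add_group_on_def)
  qed
qed

lemma in_r_coset_add: "y \<in> H #>\<^bsub>add_group_on S\<^esub> x \<longleftrightarrow> y - x \<in> H"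
  by (force simp: r_coset_def add_group_on_def algebra_simps)

lemma r_coset_add_eq_iff:
  assumes "add_subgroup H"
  shows "H #>\<^bsub>add_group_on S\<^esub> x = H #>\<^bsub>add_group_on S\<^esub> y \<longleftrightarrow> x - y \<in> H"
proof
  assume "H #>\<^bsub>add_group_on S\<^esub> x = H #>\<^bsub>add_group_on S\<^esub> y"
  moreover have "x \<in> H #>\<^bsub>add_group_on S\<^esub> x"
    using assms by (simp add: in_r_coset_add add_subgroup_def)
  ultimately show "x - y \<in> H"
    using in_r_coset_add by metis
next
  assume xy: "x - y \<in> H"
  have "z - x \<in> H \<longleftrightarrow> z - y \<in> H" for z
    using add_subgroup_plus[OF assms _ xy, of "z - x"] add_subgroup_diff[OF assms _ xy, of "z - y"]
    by (auto simp: algebra_simps)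
  then show "H #>\<^bsub>add_group_on S\<^esub> x = H #>\<^bsub>add_group_on S\<^esub> y"
    by (auto simp: in_r_coset_add)
qed

text \<open>The cosets of j t for j < m exhaust the quotient by division with remainder. A
  coincidence would put (j - i) t into H with 0 < j - i < m, and as m is prime, t as well.\<close>

lemma card_cosets_cyclic:
  assumes S: "add_subgroup S" and H: "add_subgroup H" "H \<subseteq> S" and t: "t \<in> S - H"
    and m: "m = 2 \<or> m = 3" and mt: "real m *\<^sub>R t \<in> H"
    and gen: "\<And>y. y \<in> S \<Longrightarrow> \<exists>n\<in>\<int>. y - n *\<^sub>R t \<in> H"
  shows "card (rcosets\<^bsub>add_group_on S\<^esub> H) = m"
proof -
  let ?C = "\<lambda>x. H #>\<^bsub>add_group_on S\<^esub> x"
  have "rcosets\<^bsub>add_group_on S\<^esub> H = (\<lambda>j. ?C (real j *\<^sub>R t)) ` {..<m}"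
  proof (intro equalityI subsetI)
    fix X assume "X \<in> rcosets\<^bsub>add_group_on S\<^esub> H"
    then obtain x where x: "x \<in> S" "X = ?C x"
      by (auto simp: RCOSETS_def add_group_on_def)
    obtain n :: int where n: "x - of_int n *\<^sub>R t \<in> H"
      using gen[OF x(1)] by (auto elim: Ints_cases)
    define j where "j = nat (n mod int m)"
    have "n = int m * (n div int m) + int j"
      using m by (auto simp: j_def)
    then have "of_int n = real m * of_int (n div int m) + real j"
      by (metis of_int_add of_int_mult of_int_of_nat_eq)
    then have "x - real j *\<^sub>R t = (x - of_int n *\<^sub>R t) + of_int (n div int m) *\<^sub>R (real m *\<^sub>R t)"
      by (simp add: algebra_simps)
    also have "\<dots> \<in> H"
      by (rule add_subgroup_plus[OF H(1) n add_subgroup_scale_Ints[OF H(1) mt Ints_of_int]])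
    finally have "X = ?C (real j *\<^sub>R t)"
      by (simp add: x(2) r_coset_add_eq_iff[OF H(1)])
    moreover have "j < m"
      using m by (auto simp: j_def nat_less_iff)
    ultimately show "X \<in> (\<lambda>j. ?C (real j *\<^sub>R t)) ` {..<m}" by blast
  next
    fix X assume "X \<in> (\<lambda>j. ?C (real j *\<^sub>R t)) ` {..<m}"
    then obtain j where "X = ?C (real j *\<^sub>R t)" by blast
    moreover have "real j *\<^sub>R t \<in> S"
      using add_subgroup_scale_nat[OF S] t by blast
    ultimately show "X \<in> rcosets\<^bsub>add_group_on S\<^esub> H"
      unfolding RCOSETS_def by (auto simp: add_group_on_def)
  qed
  moreover have "inj_on (\<lambda>j. ?C (real j *\<^sub>R t)) {..<m}"
  proof (rule linorder_inj_onI)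
    fix i j assume ij: "i < j" "i \<in> {..<m}" "j \<in> {..<m}"
    show "?C (real i *\<^sub>R t) \<noteq> ?C (real j *\<^sub>R t)"
    proof
      assume "?C (real i *\<^sub>R t) = ?C (real j *\<^sub>R t)"
      then have "real j *\<^sub>R t - real i *\<^sub>R t \<in> H"
        using r_coset_add_eq_iff[OF H(1)] by metis
      then have d: "real (j - i) *\<^sub>R t \<in> H"
        using ij(1) by (simp add: of_nat_diff scaleR_left_diff_distrib)
      have "j - i = 1 \<or> m = 3 \<and> j - i = 2"
        using ij m by auto
      then have "t \<in> H"
      proof
        assume 2: "m = 3 \<and> j - i = 2"
        then have "3 *\<^sub>R t - 2 *\<^sub>R t \<in> H"
          using add_subgroup_diff[OF H(1) mt d] by simp
        then show ?thesis by (simp flip: scaleR_left_diff_distrib)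
      qed (use d in simp)
      then show False using t by blast
    qed
  qed auto
  ultimately show ?thesis
    by (simp add: card_image)
qed

section \<open>Homomorphisms on the short root lattice and their linear lifts\<close>

context affine_two_lengths
begin

text \<open>Ensures that v \<mapsto> H + L v takes values in the quotient of
  \<open>\<Lambda>s\<close> on the whole lattice, as \<open>Z_linear\<close> demands.\<close>

lemma linear_Z_span:
  assumes "linear L" "\<And>\<alpha>. \<alpha> \<in> sh \<Longrightarrow> L \<alpha> \<in> \<Lambda>s"
    and "v \<in> carrier (subgroup_generated (add_group_on UNIV) sh)"
  shows "L v \<in> \<Lambda>s"
proof -
  have "v \<in> generate (add_group_on UNIV) sh"
    using assms(3) by (simp add: carrier_subgroup_generated add_group_on_def)
  then show ?thesis
  proof (induction rule: generate.induct)
    case one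
    then show ?case using zero_in_Ls by (simp add: add_group_on_def linear_0[OF assms(1)])
  next
    case (incl h)
    then show ?case by (rule assms(2))
  next
    case (inv h)
    then show ?case
      using add_subgroup_minus[OF subgroup_Ls assms(2)]
      by (simp add: add_subgroup_inv add_subgroup_def linear_neg[OF assms(1)])
  next
    case (eng h1 h2)
    then show ?case
      using add_subgroup_plus[OF subgroup_Ls]
      by (simp add: add_group_on_def linear_add[OF assms(1)])
  qed
qed

text \<open>Passing to cosets turns L into \<tau>. Conversely, the homomorphism behind \<tau> has
  cosets as values, and \<open>lift\<close> selects elements of them linearly; both directions then
  reduce to admissible pairs.\<close>

theorem maximal_semi_closed_iff:
  "maximal_closed_subroot_system R \<Lambda> \<Psi> \<and> semi_closed R (gradient R \<Lambda> \<Psi>) \<longleftrightarrow>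
    (\<exists>H \<tau>. maximal_subgroup H (add_group_on \<Lambda>s) \<and>
           card (rcosets\<^bsub>add_group_on \<Lambda>s\<^esub> H) = m \<and>
           \<Lambda>l \<subseteq> H \<and>
           Z_linear sh (add_group_on \<Lambda>s Mod H) \<tau> \<and>
           (\<forall>(\<alpha>, \<beta>) \<in> Gamma_s R. \<tau> \<alpha> \<noteq> inv\<^bsub>add_group_on \<Lambda>s Mod H\<^esub> (\<tau> \<beta>)) \<and>
           \<Psi> = (\<Union>\<alpha>\<in>sh. {\<alpha>} \<times> \<tau> \<alpha>))"
  (is "?lhs \<longleftrightarrow> (\<exists>H \<tau>. ?rhs H \<tau>)")
proof -
  let ?G = "add_group_on \<Lambda>s" and ?Q = "subgroup_generated (add_group_on UNIV) sh"
  interpret G: comm_group ?G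
    using add_subgroup_group[OF subgroup_Ls] .
  interpret V: comm_group "add_group_on (UNIV :: 'a set)"
    by (rule add_subgroup_group) (simp add: add_subgroup_def)
  have normal: "H \<lhd> ?G" if "add_subgroup H" "H \<subseteq> \<Lambda>s" for H
    using that by (simp add: G.subgroup_imp_normal subgroup_add_group_on[OF subgroup_Ls])
  have carrier: "carrier ?G = \<Lambda>s"
    by (simp add: add_group_on_def)
  have maxsub: "maximal_subgroup H ?G \<longleftrightarrow> add_subgroup H \<and> H \<subset> \<Lambda>s \<and>
      (\<forall>K. add_subgroup K \<and> H \<subseteq> K \<and> K \<subseteq> \<Lambda>s \<longrightarrow> K = H \<or> K = \<Lambda>s)" for H
    unfolding maximal_subgroup_def subgroup_add_group_on[OF subgroup_Ls] carrier by blast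
  have inv_coset: "inv\<^bsub>?G Mod H\<^esub> (H #>\<^bsub>?G\<^esub> x) = H #>\<^bsub>?G\<^esub> (- x)"
    if H: "add_subgroup H" "H \<subseteq> \<Lambda>s" and x: "x \<in> \<Lambda>s" for H x
  proof -
    interpret N: normal H ?G using normal[OF H] .
    have "H #>\<^bsub>?G\<^esub> x \<in> carrier (?G Mod H)"
      using x by (auto simp: FactGroup_def RCOSETS_def carrier)
    then have "inv\<^bsub>?G Mod H\<^esub> (H #>\<^bsub>?G\<^esub> x) = set_inv\<^bsub>?G\<^esub> (H #>\<^bsub>?G\<^esub> x)"
      by (rule N.inv_FactGroup)
    also have "\<dots> = H #>\<^bsub>?G\<^esub> (inv\<^bsub>?G\<^esub> x)"
      using x by (intro N.rcos_inv) (simp add: carrier)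
    finally show ?thesis
      using add_subgroup_inv[OF subgroup_Ls x] by simp
  qed
  have inv_iff: "H #>\<^bsub>?G\<^esub> (L \<alpha>) = inv\<^bsub>?G Mod H\<^esub> (H #>\<^bsub>?G\<^esub> (L \<beta>)) \<longleftrightarrow> L (\<alpha> + \<beta>) \<in> H"
    if "add_subgroup H" "H \<subseteq> \<Lambda>s" "linear L" "L \<beta> \<in> \<Lambda>s" for H L \<alpha> \<beta>
    using that by (simp add: inv_coset r_coset_add_eq_iff linear_add)
  have Psi: "(\<Union>\<alpha>\<in>sh. {\<alpha>} \<times> (H #>\<^bsub>?G\<^esub> (L \<alpha>))) = short_coset_roots L H" for H L
    by (auto simp: short_coset_roots_def in_r_coset_add)
  show ?thesis
  proof
    assume ?lhs
    then obtain L H t where adm: "admissible L H" and P: "\<Psi> = short_coset_roots L H"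
      and t: "t \<in> \<Lambda>s - H" "\<And>y. y \<in> \<Lambda>s \<Longrightarrow> real m *\<^sub>R y \<in> H"
        "\<And>y. y \<in> \<Lambda>s \<Longrightarrow> \<exists>n\<in>\<int>. y - n *\<^sub>R t \<in> H"
      using maximal_imp_admissible[of \<Psi>] by blast
    have L: "linear L" "\<And>\<alpha>. \<alpha> \<in> sh \<Longrightarrow> L \<alpha> \<in> \<Lambda>s" and H: "add_subgroup H" "H \<subseteq> \<Lambda>s"
      and Ll: "\<Lambda>l \<subseteq> H" and Lg: "\<And>\<gamma>. \<gamma> \<in> lo \<Longrightarrow> L \<gamma> \<notin> H"
      using adm unfolding admissible_def by blast+
    interpret N: normal H ?G using normal[OF H] .
    \<comment> \<open>Defined on all vectors, so that it is its own homomorphic extension to the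
      lattice.\<close>
    define \<tau> where "\<tau> v = H #>\<^bsub>?G\<^esub> (L v)" for v
    have Q: "L v \<in> \<Lambda>s" if "v \<in> carrier ?Q" for v
      using linear_Z_span[OF L that] .
    have "\<tau> \<in> hom ?Q (?G Mod H)"
    proof (rule homI)
      fix v assume "v \<in> carrier ?Q"
      then show "\<tau> v \<in> carrier (?G Mod H)"
        using Q by (auto simp: \<tau>_def FactGroup_def RCOSETS_def carrier)
    next
      fix v w assume vw: "v \<in> carrier ?Q" "w \<in> carrier ?Q"
      have "\<tau> v <#>\<^bsub>?G\<^esub> \<tau> w = H #>\<^bsub>?G\<^esub> (L v \<otimes>\<^bsub>?G\<^esub> L w)"
        unfolding \<tau>_def using Q vw by (intro N.rcos_sum) (simp_all add: carrier)
      then show "\<tau> (v \<otimes>\<^bsub>?Q\<^esub> w) = \<tau> v \<otimes>\<^bsub>?G Mod H\<^esub> \<tau> w"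
        by (simp add: \<tau>_def FactGroup_def linear_add[OF L(1)]) (simp add: add_group_on_def linear_add[OF L(1)])
    qed
    then have "Z_linear sh (?G Mod H) \<tau>"
      unfolding Z_linear_def by blast
    moreover have "\<tau> \<alpha> \<noteq> inv\<^bsub>?G Mod H\<^esub> (\<tau> \<beta>)" if "(\<alpha>, \<beta>) \<in> Gamma_s R" for \<alpha> \<beta>
    proof -
      have "\<beta> \<in> sh" "\<alpha> + \<beta> \<in> lo"
        using that by (auto simp: Gamma_s_def)
      then show ?thesis
        unfolding \<tau>_def using inv_iff[OF H L(1)] L(2) Lg by blast
    qed
    moreover have "maximal_subgroup H ?G"
      using adm unfolding maxsub admissible_def by blast
    moreover have "card (rcosets\<^bsub>?G\<^esub> H) = m"
      using card_cosets_cyclic[OF subgroup_Ls H t(1) m _ t(3)] t(1,2) by blast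
    moreover have "\<Psi> = (\<Union>\<alpha>\<in>sh. {\<alpha>} \<times> \<tau> \<alpha>)"
      unfolding P \<tau>_def Psi ..
    ultimately show "\<exists>H \<tau>. ?rhs H \<tau>"
      using Ll by blast
  next
    assume "\<exists>H \<tau>. ?rhs H \<tau>"
    then obtain H \<tau> where max: "maximal_subgroup H ?G" and Ll: "\<Lambda>l \<subseteq> H"
      and lin: "Z_linear sh (?G Mod H) \<tau>"
      and Gam: "\<And>\<alpha> \<beta>. (\<alpha>, \<beta>) \<in> Gamma_s R \<Longrightarrow> \<tau> \<alpha> \<noteq> inv\<^bsub>?G Mod H\<^esub> (\<tau> \<beta>)"
      and P: "\<Psi> = (\<Union>\<alpha>\<in>sh. {\<alpha>} \<times> \<tau> \<alpha>)"
      by blast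
    have H: "add_subgroup H" "H \<subseteq> \<Lambda>s"
      using max unfolding maxsub by blast+
    interpret N: normal H ?G using normal[OF H] .
    obtain f where f: "f \<in> hom ?Q (?G Mod H)" and \<tau>f: "\<And>\<alpha>. \<alpha> \<in> sh \<Longrightarrow> \<tau> \<alpha> = f \<alpha>"
      using lin unfolding Z_linear_def by blast
    have Q: "\<alpha> \<in> carrier ?Q" if "\<alpha> \<in> sh" for \<alpha>
      using that by (simp add: carrier_subgroup_generated add_group_on_def generate.incl)
    have coset: "\<exists>x\<in>\<Lambda>s. f v = H #>\<^bsub>?G\<^esub> x" if "v \<in> carrier ?Q" for v
      using hom_in_carrier[OF f that] by (auto simp: FactGroup_def RCOSETS_def carrier)
    have coset_eq: "f v = H #>\<^bsub>?G\<^esub> y" if v: "v \<in> carrier ?Q" and y: "y \<in> f v" for v y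
    proof -
      obtain x where "f v = H #>\<^bsub>?G\<^esub> x" using coset[OF v] by blast
      then show ?thesis
        using y H(1) add_subgroup_minus[OF H(1), of "y - x"] by (simp add: in_r_coset_add r_coset_add_eq_iff)
    qed
    have f_add: "y + z \<in> f (v + w)" if vw: "v \<in> carrier ?Q" "w \<in> carrier ?Q" and yz: "y \<in> f v" "z \<in> f w" for v w y z
    proof -
      have "f (v + w) = f v <#>\<^bsub>?G\<^esub> f w"
        using hom_mult[OF f vw] by (simp add: FactGroup_def) (simp add: add_group_on_def)
      then show ?thesis
        using yz by (auto simp: set_mult_def add_group_on_def)
    qed
    \<comment> \<open>Supplies the negation hypothesis of \<open>lift\<close>: elements of f
      (-\<alpha>) and f \<alpha> add up to an element of f 0.\<close>
    have f0: "f 0 = H"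
      using hom_one[OF f V.group_subgroup_generated N.factorgroup_is_group]
      by (simp add: FactGroup_def) (simp add: add_group_on_def)
    have "\<exists>L::'a \<Rightarrow> 'b. linear L \<and> (\<forall>\<alpha>\<in>sh. L \<alpha> \<in> f \<alpha>)"
    proof (rule lift)
      fix \<alpha> assume "\<alpha> \<in> sh"
      then obtain x where "f \<alpha> = H #>\<^bsub>?G\<^esub> x" using coset Q by blast
      then have "x \<in> f \<alpha>" using H(1) by (simp add: in_r_coset_add add_subgroup_def)
      then show "f \<alpha> \<noteq> {}" by blast
    next
      fix \<alpha> y assume a: "\<alpha> \<in> sh" and y: "y \<in> f \<alpha>"
      obtain x where x: "f (- \<alpha>) = H #>\<^bsub>?G\<^esub> x" using coset Q neg_short[OF a] by blast
      then have "x \<in> f (- \<alpha>)" using H(1) by (simp add: in_r_coset_add add_subgroup_def)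
      from f_add[OF Q[OF neg_short[OF a]] Q[OF a] this y] have "x + y \<in> H"
        using f0 by simp
      from add_subgroup_minus[OF H(1) this] show "- y \<in> f (- \<alpha>)"
        by (simp add: x in_r_coset_add add.commute[of x y])
    next
      fix \<alpha> \<beta> y z
      assume "\<alpha> \<in> sh" "\<beta> \<in> sh" "y \<in> f \<alpha>" "z \<in> f \<beta>"
      then show "y + z \<in> f (\<alpha> + \<beta>)" using f_add Q by blast
    qed
    then obtain L where L: "linear L" "\<And>\<alpha>. \<alpha> \<in> sh \<Longrightarrow> L \<alpha> \<in> f \<alpha>" by blast
    have \<tau>L: "\<tau> \<alpha> = H #>\<^bsub>?G\<^esub> (L \<alpha>)" if "\<alpha> \<in> sh" for \<alpha>
      using coset_eq[OF Q[OF that] L(2)[OF that]] \<tau>f[OF that] by simp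
    have LLs: "L \<alpha> \<in> \<Lambda>s" if a: "\<alpha> \<in> sh" for \<alpha>
    proof -
      obtain x where "x \<in> \<Lambda>s" "f \<alpha> = H #>\<^bsub>?G\<^esub> x" using coset[OF Q[OF a]] by blast
      then show ?thesis
        using L(2)[OF a] H(2) add_subgroup_plus[OF subgroup_Ls, of "L \<alpha> - x" x] by (auto simp: in_r_coset_add)
    qed
    have "L \<gamma> \<notin> H" if g: "\<gamma> \<in> lo" for \<gamma>
    proof -
      obtain \<alpha> \<beta> where ab: "\<alpha> \<in> sh" "\<beta> \<in> sh" "\<gamma> = \<alpha> + \<beta>"
        using long_sum[OF g] by blast
      then have "(\<alpha>, \<beta>) \<in> Gamma_s R"
        using g by (simp add: Gamma_s_def)
      from Gam[OF this] show ?thesis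
        using inv_iff[OF H L(1) LLs[OF ab(2)]] \<tau>L ab by simp
    qed
    then have "admissible L H"
      using L(1) LLs H max Ll unfolding admissible_def maxsub by blast
    moreover have "\<Psi> = short_coset_roots L H"
      unfolding P Psi[symmetric] using \<tau>L by simp
    ultimately show ?lhs
      using admissible_imp_maximal by simp
  qed
qed

end

section \<open>Reduction to the standard models\<close>

text \<open>As R spans the space, the isomorphism is bijective and the basis vectors have preimages
  \<epsilon> b. It need not be an isometry, so orthogonality and equal lengths of the \<epsilon> b
  are recovered from Cartan integers.\<close>

lemma type_C_imp_C_roots:
  fixes R :: "'a::euclidean_space set"
  assumes R: "finite_root_system R" and C: "type_C n R" and n: "3 \<le> n"
  shows "\<exists>(\<epsilon> :: 'a \<Rightarrow> 'a) c. C_roots Basis \<epsilon> c R"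
proof -
  obtain f :: "'a \<Rightarrow> 'a" where f: "linear f" "inj_on f (span R)" "f ` R = std_C"
    and cartan: "\<And>\<alpha> \<beta>. \<alpha> \<in> R \<Longrightarrow> \<beta> \<in> R \<Longrightarrow> f \<beta> \<bullet> coroot (f \<alpha>) = \<beta> \<bullet> coroot \<alpha>"
    and dim: "DIM('a) = n"
    using C unfolding type_C_def root_system_iso_def by blast
  have inj: "inj f"
    using f(2) R by (simp add: finite_root_system_def)
  then have surj: "surj f"
    using linear_injective_imp_surjective f(1) by blast
  then have "\<forall>b. \<exists>x. f x = b"
    by (metis surjD)
  then obtain \<epsilon> where f\<epsilon>: "\<And>b. f (\<epsilon> b) = b"
    by metis
  have fpair: "f (s *\<^sub>R \<epsilon> b + t *\<^sub>R \<epsilon> b') = s *\<^sub>R b + t *\<^sub>R b'" for s t b b'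
    by (simp add: linear_add[OF f(1)] linear_cmul[OF f(1)] f\<epsilon>)
  have fsingle: "f (s *\<^sub>R \<epsilon> b) = s *\<^sub>R b" for s b
    by (simp add: linear_cmul[OF f(1)] f\<epsilon>)
  have "f ` C_short Basis \<epsilon> = {s *\<^sub>R b + t *\<^sub>R b' | s t b b'.
      s \<in> {-1, 1} \<and> t \<in> {-1, 1} \<and> b \<in> Basis \<and> b' \<in> Basis \<and> b \<noteq> b'}" (is "_ = ?S")
  proof (intro equalityI subsetI)
    fix z assume "z \<in> f ` C_short Basis \<epsilon>"
    then obtain x where x: "x \<in> C_short Basis \<epsilon>" "z = f x" by blast
    then obtain s t b b' where "s \<in> {-1, 1}" "t \<in> {-1, 1}" "b \<in> Basis" "b' \<in> Basis" "b \<noteq> b'"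
      "x = s *\<^sub>R \<epsilon> b + t *\<^sub>R \<epsilon> b'"
      unfolding C_short_def by blast
    moreover from this have "z = s *\<^sub>R b + t *\<^sub>R b'"
      by (simp only: x(2) fpair)
    ultimately show "z \<in> ?S" by blast
  next
    fix z assume "z \<in> ?S"
    then obtain s t b b' where *: "s \<in> {-1, 1}" "t \<in> {-1, 1}" "b \<in> Basis" "b' \<in> Basis" "b \<noteq> b'"
      and z: "z = s *\<^sub>R b + t *\<^sub>R b'"
      by blast
    have "s *\<^sub>R \<epsilon> b + t *\<^sub>R \<epsilon> b' \<in> C_short Basis \<epsilon>"
      using * unfolding C_short_def by blast
    then show "z \<in> f ` C_short Basis \<epsilon>"
      by (rule rev_image_eqI) (simp only: fpair z)
  qed
  moreover have "f ` C_long Basis \<epsilon> = {s *\<^sub>R b | s b. s \<in> {-2, 2} \<and> b \<in> Basis}" (is "_ = ?S")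
  proof (intro equalityI subsetI)
    fix z assume "z \<in> f ` C_long Basis \<epsilon>"
    then obtain x where x: "x \<in> C_long Basis \<epsilon>" "z = f x" by blast
    then obtain s b where "s \<in> {-2, 2}" "b \<in> Basis" "x = s *\<^sub>R \<epsilon> b"
      unfolding C_long_def by blast
    then show "z \<in> ?S"
      unfolding x(2) by (intro CollectI exI[of _ s] exI[of _ b] conjI) (simp_all only: fsingle)
  next
    fix z assume "z \<in> ?S"
    then obtain s b where *: "s \<in> {-2, 2}" "b \<in> Basis" and z: "z = s *\<^sub>R b"
      by blast
    have "s *\<^sub>R \<epsilon> b \<in> C_long Basis \<epsilon>"
      using * unfolding C_long_def by blast
    then show "z \<in> f ` C_long Basis \<epsilon>"
      by (rule rev_image_eqI) (simp only: fsingle z)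
  qed
  ultimately have "f ` R = f ` (C_short Basis \<epsilon> \<union> C_long Basis \<epsilon>)"
    unfolding f(3) std_C_def image_Un by simp
  then have R_eq: "R = C_short Basis \<epsilon> \<union> C_long Basis \<epsilon>"
    using inj by (simp add: inj_image_eq_iff)
  have long: "2 *\<^sub>R \<epsilon> b \<in> R" if "b \<in> Basis" for b
    using that unfolding R_eq C_long_def by blast
  have short: "1 *\<^sub>R \<epsilon> b + 1 *\<^sub>R \<epsilon> b' \<in> R" if "b \<in> Basis" "b' \<in> Basis" "b \<noteq> b'" for b b'
    using that unfolding R_eq C_short_def by blast
  have "0 \<notin> R" using R by (simp add: finite_root_system_def)
  then have nz: "\<epsilon> b \<noteq> 0" if "b \<in> Basis" for b
    using long[OF that] by auto
  have orth: "\<epsilon> b \<bullet> \<epsilon> b' = 0" if b: "b \<in> Basis" "b' \<in> Basis" "b \<noteq> b'" for b b'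
  proof -
    have "(2 *\<^sub>R \<epsilon> b) \<bullet> coroot (2 *\<^sub>R \<epsilon> b') = (2 *\<^sub>R b) \<bullet> coroot (2 *\<^sub>R b')"
      using cartan[OF long[OF b(2)] long[OF b(1)]] by (simp only: fsingle)
    also have "\<dots> = 0"
      using b by (simp add: inner_coroot inner_Basis)
    finally show ?thesis
      using nz[OF b(2)] by (simp add: inner_coroot)
  qed
  \<comment> \<open>The Cartan integer 2 of 2 \<epsilon> b at \<epsilon> b + \<epsilon> b' says that
    \<epsilon> b carries half of the squared length of the sum.\<close>
  have eq: "\<epsilon> b \<bullet> \<epsilon> b = \<epsilon> b' \<bullet> \<epsilon> b'" if b: "b \<in> Basis" "b' \<in> Basis" "b \<noteq> b'" for b b'
  proof -
    have "(2 *\<^sub>R \<epsilon> b) \<bullet> coroot (1 *\<^sub>R \<epsilon> b + 1 *\<^sub>R \<epsilon> b') = (2 *\<^sub>R b) \<bullet> coroot (1 *\<^sub>R b + 1 *\<^sub>R b')"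
      using cartan[OF short[OF b] long[OF b(1)]] by (simp only: fsingle fpair)
    also have "\<dots> = 2"
      using b by (simp add: inner_coroot inner_add_left inner_add_right inner_Basis)
    finally have "4 * (\<epsilon> b \<bullet> \<epsilon> b) / (\<epsilon> b \<bullet> \<epsilon> b + \<epsilon> b' \<bullet> \<epsilon> b') = 2"
      using orth[OF b] by (simp add: inner_coroot inner_add_left inner_add_right inner_commute)
    moreover have "\<epsilon> b \<bullet> \<epsilon> b + \<epsilon> b' \<bullet> \<epsilon> b' > 0"
      using nz[OF b(1)] nz[OF b(2)] by (simp add: add_pos_pos)
    ultimately show ?thesis
      by (simp add: field_simps)
  qed
  obtain b0 :: 'a where b0: "b0 \<in> Basis" using nonempty_Basis by blast
  have "C_roots Basis \<epsilon> (\<epsilon> b0 \<bullet> \<epsilon> b0) R"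
  proof
    show "3 \<le> card (Basis :: 'a set)" using dim n by simp
    show "0 < \<epsilon> b0 \<bullet> \<epsilon> b0" using nz[OF b0] by simp
    show "R = C_short Basis \<epsilon> \<union> C_long Basis \<epsilon>" by (fact R_eq)
    show "\<epsilon> b \<bullet> \<epsilon> b' = (if b = b' then \<epsilon> b0 \<bullet> \<epsilon> b0 else 0)" if "b \<in> Basis" "b' \<in> Basis" for b b'
    proof (cases "b = b'")
      case True
      have "\<epsilon> b \<bullet> \<epsilon> b = \<epsilon> b0 \<bullet> \<epsilon> b0"
        by (cases "b = b0") (simp, rule eq[OF that(1) b0])
      then show ?thesis using True by simp
    qed (use orth[OF that] in simp)
  qed
  then show ?thesis by blast
qed

text \<open>The model spans only a plane in three-space, so the axis vectors have no preimages. The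
  a i are instead the preimages of the cyclic differences e 1 - e 2, e 2 - e 3 and e 3 - e
  1.\<close>

lemma type_G2_imp_G2_roots:
  fixes R :: "'a::euclidean_space set"
  assumes R: "finite_root_system R" and G: "type_G2 R"
  shows "\<exists>a c. G2_roots a c R"
proof -
  obtain f :: "'a \<Rightarrow> real ^ 3" where f: "linear f" "inj_on f (span R)" "f ` R = std_G2"
    and cartan: "\<And>\<alpha> \<beta>. \<alpha> \<in> R \<Longrightarrow> \<beta> \<in> R \<Longrightarrow> f \<beta> \<bullet> coroot (f \<alpha>) = \<beta> \<bullet> coroot \<alpha>"
    using G unfolding type_G2_def root_system_iso_def by blast
  have inj: "inj f"
    using f(2) R by (simp add: finite_root_system_def)
  define e :: "3 \<Rightarrow> real ^ 3" where "e i = axis i 1" for i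
  have e: "e i \<bullet> e j = (if i = j then 1 else 0)" for i j
    by (simp add: e_def inner_axis_axis)
  have "e i - e j \<in> std_G2" if "i \<noteq> j" for i j
    using that unfolding std_G2_def e_def by blast
  then have "e 1 - e 2 \<in> f ` R" "e 2 - e 3 \<in> f ` R"
    unfolding f(3) by simp_all
  then obtain x y where x: "x \<in> R" "f x = e 1 - e 2" and y: "y \<in> R" "f y = e 2 - e 3"
    by (metis imageE)
  have "0 \<notin> R" using R by (simp add: finite_root_system_def)
  then have nz: "x \<bullet> x > 0" "y \<bullet> y > 0" using x y by auto
  \<comment> \<open>Cartan integer -1 in both directions forces equal lengths and an angle of 120
    degrees.\<close>
  have "(e 2 - e 3) \<bullet> coroot (e 1 - e 2) = -1" "(e 1 - e 2) \<bullet> coroot (e 2 - e 3) = -1"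
    by (simp_all add: inner_coroot inner_diff_left inner_diff_right e)
  then have "y \<bullet> coroot x = -1" "x \<bullet> coroot y = -1"
    using cartan[OF x(1) y(1)] cartan[OF y(1) x(1)] unfolding x(2) y(2) by simp_all
  then have xy: "y \<bullet> x = - (x \<bullet> x) / 2" "y \<bullet> y = x \<bullet> x"
    using nz by (simp_all add: inner_coroot inner_commute[of x y] field_simps)
  define a :: "3 \<Rightarrow> 'a" where "a i = (if i = 1 then x else if i = 2 then y else - (x + y))" for i
  have a: "a 1 = x" "a 2 = y" "a 3 = - (x + y)"
    by (simp_all add: a_def)
  have fa: "f (a 1) = e 1 - e 2" "f (a 2) = e 2 - e 3" "f (a 3) = e 3 - e 1"
    by (simp_all add: a x y linear_neg[OF f(1)] linear_diff[OF f(1)])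
  have ex3: "(\<exists>i::3. P i) \<longleftrightarrow> P 1 \<or> P 2 \<or> P 3" for P
    by (metis exhaust_3)
  have short: "f ` G2_short a = {e i - e j | i j. i \<noteq> j}"
  proof -
    have "G2_short a = {a 1, a 2, a 3, - a 1, - a 2, - a 3}"
      by (auto simp: G2_short_def ex3)
    moreover have "{e i - e j | i j. i \<noteq> j} =
        {e 1 - e 2, e 1 - e 3, e 2 - e 1, e 2 - e 3, e 3 - e 1, e 3 - e 2}"
      by (auto simp: ex3)
    ultimately show ?thesis
      by (auto simp: fa linear_neg[OF f(1)])
  qed
  have long: "f ` G2_long a = {s *\<^sub>R (2 *\<^sub>R e i - e j - e k) | s i j k.
      s \<in> {-1, 1} \<and> i \<noteq> j \<and> j \<noteq> k \<and> i \<noteq> k}" (is "_ = ?S")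
  proof -
    have "G2_long a = {a 1 - a 2, a 1 - a 3, a 2 - a 1, a 2 - a 3, a 3 - a 1, a 3 - a 2}"
      by (auto simp: G2_long_def ex3)
    moreover have "?S = {2 *\<^sub>R e 1 - e 2 - e 3, 2 *\<^sub>R e 2 - e 1 - e 3, 2 *\<^sub>R e 3 - e 1 - e 2,
        - (2 *\<^sub>R e 1 - e 2 - e 3), - (2 *\<^sub>R e 2 - e 1 - e 3), - (2 *\<^sub>R e 3 - e 1 - e 2)}" (is "_ = ?T")
    proof
      show "?S \<subseteq> ?T"
      proof
        fix z assume "z \<in> ?S"
        then obtain s i j k where z: "z = s *\<^sub>R (2 *\<^sub>R e i - e j - e k)" "s = -1 \<or> s = 1"
          "i \<noteq> j" "j \<noteq> k" "i \<noteq> k" by blast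
        show "z \<in> ?T"
          using z(2-5) exhaust_3[of i] exhaust_3[of j] exhaust_3[of k] unfolding z(1)
          by (elim disjE) (simp_all add: algebra_simps)
      qed
      have "s *\<^sub>R (2 *\<^sub>R e i - e j - e k) \<in> ?S" if "s \<in> {-1, 1}" "i \<noteq> j" "j \<noteq> k" "i \<noteq> k" for s i j k
        using that by blast
      from this[of 1 1 2 3] this[of 1 2 1 3] this[of 1 3 1 2] this[of "-1" 1 2 3] this[of "-1" 2 1 3]
        this[of "-1" 3 1 2]
      show "?T \<subseteq> ?S" by simp
    qed
    ultimately show ?thesis
      by (simp add: fa linear_diff[OF f(1)] scaleR_2 algebra_simps insert_commute)
  qed
  have "f ` R = f ` (G2_short a \<union> G2_long a)"
    unfolding f(3) image_Un short long std_G2_def e_def ..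
  then have R_eq: "R = G2_short a \<union> G2_long a"
    using inj by (simp add: inj_image_eq_iff)
  have "G2_roots a (x \<bullet> x) R"
  proof
    show "0 < x \<bullet> x" by (fact nz)
    show "a i \<bullet> a j = (if i = j then x \<bullet> x else - (x \<bullet> x) / 2)" for i j
      using exhaust_3[of i] exhaust_3[of j] xy
      by (elim disjE) (simp_all add: a inner_diff_left inner_diff_right inner_commute[of x y])
    show "a k = - (a i + a j)" if "i \<noteq> j" "k \<noteq> i" "k \<noteq> j" for i j k
      using that exhaust_3[of i] exhaust_3[of j] exhaust_3[of k] by (elim disjE) (simp_all add: a)
    show "R = G2_short a \<union> G2_long a" by (fact R_eq)
  qed
  then show ?thesis by blast
qed

theorem theorem3:
  fixes R :: "'a::euclidean_space set"
    and Y :: "'b::real_vector set"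
    and \<Lambda> :: "'a \<Rightarrow> 'b set"
    and \<Psi> :: "('a \<times> 'b) set"
  assumes "irreducible_affine_reflection_system R Y \<Lambda>"
    and "(\<exists>n\<ge>3. type_C n R) \<or> type_G2 R"
    and "\<Psi> \<subseteq> affine_roots R \<Lambda>"
  shows "maximal_closed_subroot_system R \<Lambda> \<Psi> \<and> semi_closed R (gradient R \<Lambda> \<Psi>) \<longleftrightarrow>
    (\<exists>H \<tau>. maximal_subgroup H (add_group_on (Lambda_s R \<Lambda>)) \<and>
           card (rcosets\<^bsub>add_group_on (Lambda_s R \<Lambda>)\<^esub> H) = m_const R \<and>
           Lambda_l R \<Lambda> \<subseteq> H \<and>
           Z_linear (short_roots R) (add_group_on (Lambda_s R \<Lambda>) Mod H) \<tau> \<and>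
           (\<forall>(\<alpha>, \<beta>) \<in> Gamma_s R. \<tau> \<alpha> \<noteq> inv\<^bsub>add_group_on (Lambda_s R \<Lambda>) Mod H\<^esub> (\<tau> \<beta>)) \<and>
           \<Psi> = (\<Union>\<alpha>\<in>short_roots R. {\<alpha>} \<times> \<tau> \<alpha>))"
proof -
  have R: "finite_root_system R" and datum: "extension_datum R Y \<Lambda>"
    using assms(1) by (auto simp: irreducible_affine_reflection_system_def)
  have C: "affine_two_lengths R Y \<Lambda> 2" if "n \<ge> 3" "type_C n R" for n
    using type_C_imp_C_roots[OF R that(2,1)] C_roots.C_affine_two_lengths[OF _ R datum] by blast
  have "affine_two_lengths R Y \<Lambda> (m_const R)"
  proof (cases "\<exists>n\<ge>3. type_C n R")
    case True
    then show ?thesis using C by (auto simp: m_const_def)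
  next
    case False
    then have "type_G2 R" using assms(2) by blast
    then have "affine_two_lengths R Y \<Lambda> 3"
      using type_G2_imp_G2_roots[OF R] G2_roots.G2_affine_two_lengths[OF _ R datum] by blast
    moreover have "m_const R = 3"
      unfolding m_const_def using False by (rule if_not_P)
    ultimately show ?thesis by simp
  qed
  then show ?thesis
    by (rule affine_two_lengths.maximal_semi_closed_iff)
qed

end
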